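(* Let $K$ be a countable field. Then $K$ is large if and only if $K$ admits a gt-henselian field topology.
   Context: A field $K$ is large if every smooth algebraic curve $C$ over $K$ with $C(K)\neq\varnothing$ has infinitely many $K$-rational points (equivalently: whenever $f(X,Y)\in K[X,Y]$ satisfies $f(0,0)=0\neq \frac{\partial f}{\partial Y}(0,0)$, the set $\{(a,b)\in K^2: f(a,b)=0\}$ is infinite). Field topologies are assumed to be Hausdorff and non-discrete. A field topology $\tau$ on $K$ is gt-henselian (generalized t-henselian) if for every $n\ge 2$ and every $\tau$-neighborhood $U$ of $-1$ there is a $\tau$-neighborhood $V$ of $0$ such that whenever $c_0,\ldots,c_{n-2}\in V$, the polynomial $X^n+X^{n-1}+c_{n-2}X^{n-2}+\cdots+c_1X+c_0$ has a root in $U$. (Equivalently, the implicit function theorem holds for polynomials with respect to $\tau$.) *)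

theory Defs
  imports "HOL-Analysis.T1_Spaces" "HOL-Computational_Algebra.Polynomial" "HOL-Library.Countable_Set"
begin

text \<open>
  Polynomials in \<open>K[X,Y]\<close> are represented as \<open>K[X][Y]\<close>, that is, as polynomials in \<open>Y\<close>
  with coefficients in \<open>K[X]\<close>. Hence \<^const>\<open>pderiv\<close> is the partial derivative with respect to \<open>Y\<close>.
\<close>

definition eval_XY :: "'a::comm_ring_1 poly poly \<Rightarrow> 'a \<Rightarrow> 'a \<Rightarrow> 'a" where
  "eval_XY f a b = poly (poly f [:b:]) a"

text \<open>
  Largeness of the field \<open>K = UNIV :: 'a set\<close>, phrased with plane curves that are smooth at the
  origin because \<open>\<partial>f/\<partial>Y\<close> does not vanish there.
\<close>

definition large_field :: "'a::field itself \<Rightarrow> bool" where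
  "large_field _ \<longleftrightarrow>
     (\<forall>f :: 'a poly poly. eval_XY f 0 0 = 0 \<and> eval_XY (pderiv f) 0 0 \<noteq> 0
        \<longrightarrow> infinite {(a, b). eval_XY f a b = 0})"

definition field_topology :: "'a::field topology \<Rightarrow> bool" where
  "field_topology \<tau> \<longleftrightarrow>
     topspace \<tau> = UNIV \<and>
     continuous_map (prod_topology \<tau> \<tau>) \<tau> (\<lambda>(x, y). x + y) \<and>
     continuous_map \<tau> \<tau> uminus \<and>
     continuous_map (prod_topology \<tau> \<tau>) \<tau> (\<lambda>(x, y). x * y) \<and>
     continuous_map (subtopology \<tau> (UNIV - {0})) \<tau> inverse \<and>
     Hausdorff_space \<tau> \<and>
     \<tau> \<noteq> discrete_topology UNIV"

definition is_nbhd :: "'a topology \<Rightarrow> 'a \<Rightarrow> 'a set \<Rightarrow> bool" where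
  "is_nbhd \<tau> x U \<longleftrightarrow> (\<exists>W. openin \<tau> W \<and> x \<in> W \<and> W \<subseteq> U)"

definition gt_henselian :: "'a::field topology \<Rightarrow> bool" where
  "gt_henselian \<tau> \<longleftrightarrow>
     (\<forall>n\<ge>2. \<forall>U. is_nbhd \<tau> (- 1) U \<longrightarrow>
        (\<exists>V. is_nbhd \<tau> 0 V \<and>
           (\<forall>c :: nat \<Rightarrow> 'a. (\<forall>i\<le>n - 2. c i \<in> V) \<longrightarrow>
              (\<exists>x\<in>U. poly (monom 1 n + monom 1 (n - 1) + (\<Sum>i\<le>n - 2. monom (c i) i)) x = 0))))"

end

theory Submission
  imports Defs "HOL-Computational_Algebra.Polynomial_FPS"
begin

text \<open>
  If \<open>K\<close> carries a gt-henselian topology and \<open>f(x, Y) = a\<^sub>0 + a\<^sub>1 Y + \<dots>\<close>, then the substitution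
  \<open>Y = a\<^sub>0 / (a\<^sub>1 w)\<close> turns \<open>f(x, Y) = 0\<close> into \<open>w\<^sup>n + w\<^sup>n\<^sup>-\<^sup>1 + \<dots> = 0\<close> with lower coefficients tending
  to \<open>0\<close> as \<open>x\<close> does, so there is a point above every small \<open>x\<close>.

  Conversely, a topology is built as an increasing union of finite approximations to a neighbourhood
  basis \<open>U\<^sub>0 \<supseteq> U\<^sub>1 \<supseteq> \<dots>\<close> of \<open>0\<close>, where field operations and roots \<open>-1 + y\<close> of the polynomials
  \<open>X\<^sup>n + X\<^sup>n\<^sup>-\<^sup>1 + \<dots>\<close> lead from level \<open>k + 1\<close> to level \<open>k\<close>. Since the elements of \<open>K\<close> are enumerated
  and act as scalars, the topology is Hausdorff as soon as \<open>1 \<notin> U\<^sub>0\<close>. To enlarge an approximation by a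
  nonzero element of a deep level, adjoin a variable \<open>t\<close> instead; Hensel's lemma in \<open>K[[t]]\<close> provides the
  roots, and only finitely many power series algebraic over \<open>K(t)\<close> occur. They generate a subfield
  \<open>K(t, z)\<close> of \<open>K((t))\<close>, where \<open>(t, z)\<close> parametrises a plane curve that is smooth at the origin.
  As \<open>K\<close> is large, the curve has a rational point at which finitely many prescribed nonzero functions
  are defined and nonzero; evaluation there specialises \<open>t\<close> and the power series to elements of \<open>K\<close>.
\<close>

unbundle fps_syntax

section \<open>Evaluation of polynomials along a ring homomorphism\<close>

text \<open>Finiteness shapes the construction: at a point of the curve only finitely many functions
  can be kept from vanishing. So the step from level \<open>k + 1\<close> to level \<open>k\<close>
  involves only the first \<open>k + 1\<close> scalars and degrees up to \<open>k + 2\<close>, and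
  every approximation stays finite. The other obstacle is that K may be imperfect, in which case a
  finite extension of K(t) need not have a primitive element. Algebraic extensions of K(t) inside
  K((t)) are separable, however, and this is proved directly for relations that contain an extra
  indeterminate \<open>c\<close>. No fraction field is formed: statements about K(t) and K(t, z) are
  written over K[t] with denominators multiplied out.\<close>

locale coeff_hom =
  fixes \<iota> :: "'d::idom \<Rightarrow> 'e::idom"
  assumes hom_add: "\<iota> (a + b) = \<iota> a + \<iota> b"
    and hom_mult: "\<iota> (a * b) = \<iota> a * \<iota> b"
    and hom_one: "\<iota> 1 = 1"
begin

lemma hom_zero: "\<iota> 0 = 0"
  using hom_add[of 0 0] by (metis add_0 add_cancel_right_right)

lemma hom_uminus: "\<iota> (- a) = - \<iota> a"
  using hom_add[of a "- a"] by (simp add: hom_zero eq_neg_iff_add_eq_0 add.commute)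

lemma hom_of_nat: "\<iota> (of_nat n) = of_nat n"
  by (induction n) (simp_all add: hom_zero hom_add hom_one)

lemma hom_sum: "\<iota> (sum f A) = (\<Sum>x\<in>A. \<iota> (f x))"
  by (induction A rule: infinite_finite_induct) (simp_all add: hom_zero hom_add)

definition ev :: "'e \<Rightarrow> 'd poly \<Rightarrow> 'e" where
  "ev x p = poly (map_poly \<iota> p) x"

lemma ev_0 [simp]: "ev x 0 = 0"
  by (simp add: ev_def)

lemma ev_pCons: "ev x (pCons a p) = \<iota> a + x * ev x p"
  by (simp add: ev_def map_poly_pCons hom_zero)

lemma ev_const [simp]: "ev x [:a:] = \<iota> a"
  by (simp add: ev_pCons)

lemma ev_1 [simp]: "ev x 1 = 1"
  by (simp add: one_pCons hom_one del: pCons_one)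

lemma ev_add: "ev x (p + q) = ev x p + ev x q"
  by (induction p q rule: poly_induct2) (simp_all add: ev_pCons hom_add algebra_simps)

lemma ev_smult: "ev x (smult a p) = \<iota> a * ev x p"
  by (induction p) (simp_all add: ev_pCons hom_mult algebra_simps)

lemma ev_mult: "ev x (p * q) = ev x p * ev x q"
  by (induction p) (simp_all add: ev_pCons ev_add ev_smult hom_zero algebra_simps)

lemma ev_uminus: "ev x (- p) = - ev x p"
  by (induction p) (simp_all add: ev_pCons hom_uminus algebra_simps)

lemma ev_diff: "ev x (p - q) = ev x p - ev x q"
  using ev_add[of x p "- q"] by (simp add: ev_uminus)

lemma ev_monom: "ev x (monom a n) = \<iota> a * x ^ n"
  by (simp add: ev_def map_poly_monom hom_zero poly_monom)

lemma ev_sum: "ev x (sum f A) = (\<Sum>i\<in>A. ev x (f i))"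
  by (induction A rule: infinite_finite_induct) (simp_all add: ev_add)

lemma ev_altdef: "degree p \<le> n \<Longrightarrow> ev x p = (\<Sum>i\<le>n. \<iota> (coeff p i) * x ^ i)"
  by (subst poly_as_sum_of_monoms'[symmetric, of p n]) (simp_all add: ev_sum ev_monom)

lemma ev_ev: "ev (ev x q) p = ev x (pcompose p q)"
  by (induction p) (simp_all add: ev_pCons pcompose_pCons ev_add ev_mult)

lemma map_poly_coeff_hom: "coeff_hom (map_poly \<iota>)"
proof
  fix p q :: "'d poly"
  show add: "map_poly \<iota> (p + q) = map_poly \<iota> p + map_poly \<iota> q" for p q
    by (intro poly_eqI) (simp add: coeff_map_poly hom_zero hom_add)
  show "map_poly \<iota> (p * q) = map_poly \<iota> p * map_poly \<iota> q"
    by (intro poly_eqI) (simp add: coeff_map_poly hom_zero hom_sum hom_mult coeff_mult)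
  show "map_poly \<iota> 1 = 1"
    by (simp add: hom_one)
qed

lemma map_poly_pderiv: "map_poly \<iota> (pderiv p) = pderiv (map_poly \<iota> p)"
  by (intro poly_eqI)
     (simp add: coeff_map_poly hom_zero coeff_pderiv hom_mult hom_add hom_one hom_of_nat)

text \<open>The chain rule, where \<open>d\<close> is the matching derivation of the coefficients.
  It is applied to the derivative in \<open>c\<close>, and to the coefficientwise derivative in
  \<open>t\<close>, of a relation evaluated at \<open>W\<close>.\<close>

lemma derivation_ev:
  assumes add: "\<And>x y. \<delta> (x + y) = \<delta> x + \<delta> y"
    and mult: "\<And>x y. \<delta> (x * y) = x * \<delta> y + \<delta> x * y"
    and d: "\<And>a. \<delta> (\<iota> a) = \<iota> (d a)" and d0: "d 0 = 0"
  shows "\<delta> (ev x p) = ev x (map_poly d p) + ev x (pderiv p) * \<delta> x"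
proof (induction p)
  case 0
  show ?case using d[of 0] by (simp add: d0 hom_zero)
next
  case (pCons a p)
  have "\<delta> (ev x (pCons a p)) = \<iota> (d a) + x * (ev x (map_poly d p) + ev x (pderiv p) * \<delta> x)
      + \<delta> x * ev x p"
    by (simp add: ev_pCons add mult d pCons.IH)
  then show ?case
    by (simp add: ev_pCons map_poly_pCons d0 pderiv_pCons ev_add hom_zero algebra_simps)
qed

end

section \<open>Algebraic elements\<close>

text \<open>Fraction-free Gaussian elimination: with a pivot \<open>u\<close> in column
  \<open>b0\<close>, every other row becomes \<open>u * v k b - v k b0 * v k0 b\<close>, which
  clears the column without leaving the domain.\<close>

lemma linear_dependence_idom:
  fixes v :: "'k \<Rightarrow> 'b \<Rightarrow> 'd::idom"
  assumes "finite B" "finite K" "card B < card K"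
  shows "\<exists>e. (\<exists>k\<in>K. e k \<noteq> 0) \<and> (\<forall>b\<in>B. (\<Sum>k\<in>K. e k * v k b) = 0)"
  using assms
proof (induction B arbitrary: K v rule: finite_induct)
  case empty
  then have "K \<noteq> {}" by auto
  then show ?case by (intro exI[of _ "\<lambda>_. 1"]) auto
next
  case (insert b0 B)
  show ?case
  proof (cases "\<forall>k\<in>K. v k b0 = 0")
    case True
    have "card B < card K" using insert.prems insert.hyps by simp
    with insert.IH[of K v] insert.prems obtain e where
      "\<exists>k\<in>K. e k \<noteq> 0" "\<forall>b\<in>B. (\<Sum>k\<in>K. e k * v k b) = 0" by auto
    with True show ?thesis by (intro exI[of _ e]) simp
  next
    case False
    then obtain k0 where k0: "k0 \<in> K" "v k0 b0 \<noteq> 0" by auto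
    define u where "u = v k0 b0"
    have "card B < card (K - {k0})"
      using insert.prems insert.hyps k0 by simp
    with insert.IH[of "K - {k0}" "\<lambda>k b. u * v k b - v k b0 * v k0 b"] insert.prems
    obtain e' where e': "\<exists>k\<in>K - {k0}. e' k \<noteq> 0"
      "\<forall>b\<in>B. (\<Sum>k\<in>K - {k0}. e' k * (u * v k b - v k b0 * v k0 b)) = 0"
      by auto
    define e where "e k = (if k = k0 then - (\<Sum>k\<in>K - {k0}. e' k * v k b0) else e' k * u)" for k
    have sum: "(\<Sum>k\<in>K. e k * v k b) = (\<Sum>k\<in>K - {k0}. e' k * (u * v k b - v k b0 * v k0 b))" for b
    proof -
      have "(\<Sum>k\<in>K. e k * v k b) = e k0 * v k0 b + (\<Sum>k\<in>K - {k0}. e k * v k b)"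
        using insert.prems k0 by (simp add: sum.remove)
      also have "(\<Sum>k\<in>K - {k0}. e k * v k b) = (\<Sum>k\<in>K - {k0}. e' k * u * v k b)"
        by (intro sum.cong) (auto simp: e_def)
      also have "e k0 * v k0 b = (\<Sum>k\<in>K - {k0}. - (e' k * v k b0 * v k0 b))"
        by (simp add: e_def sum_distrib_right sum_negf)
      also have "\<dots> + (\<Sum>k\<in>K - {k0}. e' k * u * v k b)
          = (\<Sum>k\<in>K - {k0}. e' k * (u * v k b - v k b0 * v k0 b))"
        by (simp add: algebra_simps flip: sum.distrib)
      finally show ?thesis .
    qed
    have "(\<Sum>k\<in>K. e k * v k b0) = 0"
      unfolding sum by (intro sum.neutral ballI) (simp add: u_def mult.commute)
    moreover have "\<exists>k\<in>K. e k \<noteq> 0"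
      using e'(1) k0(2) by (auto simp: e_def u_def)
    ultimately show ?thesis
      using e'(2) by (intro exI[of _ e]) (auto simp: sum)
  qed
qed

locale inj_coeff_hom = coeff_hom \<iota> for \<iota> :: "'d::idom \<Rightarrow> 'e::idom" +
  assumes hom_eq_0D: "\<iota> a = 0 \<Longrightarrow> a = 0"
begin

definition algebraic_over :: "'e \<Rightarrow> bool" where
  "algebraic_over x \<longleftrightarrow> (\<exists>p. p \<noteq> 0 \<and> ev x p = 0)"

text \<open>The linear span of \<open>B\<close> over the fraction field of \<open>D\<close>, written without denominators.\<close>

definition frac_span :: "'e set \<Rightarrow> 'e set" where
  "frac_span B = {x. \<exists>m a. m \<noteq> 0 \<and> \<iota> m * x = (\<Sum>b\<in>B. \<iota> (a b) * b)}"

lemma frac_span_base: "finite B \<Longrightarrow> b \<in> B \<Longrightarrow> b \<in> frac_span B"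
  unfolding frac_span_def
  by (intro CollectI exI[of _ 1] exI[of _ "\<lambda>c. if c = b then 1 else 0"])
     (simp add: hom_one hom_zero if_distrib[of \<iota>] if_distrib[of "\<lambda>u. u * _"] cong: if_cong)

lemma frac_span_0: "0 \<in> frac_span B"
  unfolding frac_span_def
  by (intro CollectI exI[of _ 1] exI[of _ "\<lambda>_. 0"]) (simp add: hom_zero)

lemma frac_span_add:
  assumes "x \<in> frac_span B" "y \<in> frac_span B"
  shows "x + y \<in> frac_span B"
proof -
  obtain m a n c where "m \<noteq> 0" "\<iota> m * x = (\<Sum>b\<in>B. \<iota> (a b) * b)"
    "n \<noteq> 0" "\<iota> n * y = (\<Sum>b\<in>B. \<iota> (c b) * b)"
    using assms unfolding frac_span_def by blast
  moreover have "\<iota> (m * n) * (x + y) = \<iota> n * (\<iota> m * x) + \<iota> m * (\<iota> n * y)"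
    by (simp add: hom_mult algebra_simps)
  ultimately show ?thesis
    unfolding frac_span_def
    by (intro CollectI exI[of _ "m * n"] exI[of _ "\<lambda>b. n * a b + m * c b"])
       (simp add: hom_add hom_mult sum_distrib_left sum.distrib algebra_simps)
qed

lemma frac_span_scale: "x \<in> frac_span B \<Longrightarrow> \<iota> c * x \<in> frac_span B"
proof -
  assume "x \<in> frac_span B"
  then obtain m a where "m \<noteq> 0" "\<iota> m * x = (\<Sum>b\<in>B. \<iota> (a b) * b)"
    unfolding frac_span_def by blast
  moreover have "\<iota> m * (\<iota> c * x) = \<iota> c * (\<iota> m * x)" by (simp add: mult_ac)
  ultimately show ?thesis
    unfolding frac_span_def
    by (intro CollectI exI[of _ m] exI[of _ "\<lambda>b. c * a b"])
       (simp add: hom_mult sum_distrib_left mult_ac)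
qed

lemma frac_span_sum: "(\<And>i. i \<in> I \<Longrightarrow> f i \<in> frac_span B) \<Longrightarrow> sum f I \<in> frac_span B"
  by (induction I rule: infinite_finite_induct) (simp_all add: frac_span_0 frac_span_add)

lemma frac_span_divide:
  assumes "\<iota> m * x \<in> frac_span B" "m \<noteq> 0"
  shows "x \<in> frac_span B"
proof -
  obtain n a where "n \<noteq> 0" "\<iota> n * (\<iota> m * x) = (\<Sum>b\<in>B. \<iota> (a b) * b)"
    using assms(1) unfolding frac_span_def by blast
  then show ?thesis
    using assms(2) unfolding frac_span_def
    by (intro CollectI exI[of _ "n * m"] exI[of _ a]) (simp add: hom_mult mult_ac)
qed

text \<open>The \<open>card B + 1\<close> powers up to \<open>x ^ card B\<close> lie in a space of
  dimension at most \<open>card B\<close>. A dependence between their coordinate vectors, multiplied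
  by the denominators \<open>m k\<close>, is a polynomial relation.\<close>

lemma algebraic_over_if_powers:
  assumes "finite B" "\<And>k. x ^ k \<in> frac_span B"
  shows "algebraic_over x"
proof -
  have "\<forall>k. \<exists>m. m \<noteq> 0 \<and> (\<exists>a. \<iota> m * x ^ k = (\<Sum>b\<in>B. \<iota> (a b) * b))"
    using assms(2) unfolding frac_span_def by blast
  from choice[OF this] obtain m where m: "\<And>k. m k \<noteq> 0"
    and "\<forall>k. \<exists>a. \<iota> (m k) * x ^ k = (\<Sum>b\<in>B. \<iota> (a b) * b)"
    by blast
  from choice[OF this(2)] obtain a where a: "\<And>k. \<iota> (m k) * x ^ k = (\<Sum>b\<in>B. \<iota> (a k b) * b)"
    by blast
  obtain e k0 where e: "k0 \<le> card B" "e k0 \<noteq> 0" "\<And>b. b \<in> B \<Longrightarrow> (\<Sum>k\<le>card B. e k * a k b) = 0"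
    using linear_dependence_idom[of B "{..card B}" a] assms(1) by auto
  define p where "p = (\<Sum>k\<le>card B. monom (e k * m k) k)"
  have "coeff p k0 = e k0 * m k0"
    using e(1) by (simp add: p_def coeff_sum)
  then have p: "p \<noteq> 0" using e(2) m by auto
  have "ev x p = (\<Sum>k\<le>card B. \<iota> (e k) * (\<Sum>b\<in>B. \<iota> (a k b) * b))"
    by (simp add: p_def ev_sum ev_monom hom_mult mult.assoc a)
  also have "\<dots> = (\<Sum>b\<in>B. \<iota> (\<Sum>k\<le>card B. e k * a k b) * b)"
    by (simp add: sum_distrib_left sum_distrib_right hom_sum hom_mult mult.assoc)
       (rule sum.swap)
  also have "\<dots> = 0"
    by (intro sum.neutral) (simp add: e(3) hom_zero)
  finally show ?thesis using p unfolding algebraic_over_def by blast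
qed

text \<open>Stands in for a finite extension field: two algebraic elements are put into one such
  ring, and all powers of their sum and product then lie in one finite-dimensional span.\<close>

definition finite_rank_subring :: "'e set \<Rightarrow> bool" where
  "finite_rank_subring A \<longleftrightarrow> range \<iota> \<subseteq> A \<and> (\<forall>x\<in>A. \<forall>y\<in>A. x + y \<in> A \<and> x * y \<in> A) \<and>
     (\<exists>B. finite B \<and> A \<subseteq> frac_span B)"

lemma finite_rank_subringD:
  assumes "finite_rank_subring A"
  shows "\<iota> a \<in> A" "x \<in> A \<Longrightarrow> y \<in> A \<Longrightarrow> x + y \<in> A" "x \<in> A \<Longrightarrow> y \<in> A \<Longrightarrow> x * y \<in> A"
    "0 \<in> A" "1 \<in> A" "x \<in> A \<Longrightarrow> - x \<in> A"
proof -
  show *: "\<iota> a \<in> A" "x \<in> A \<Longrightarrow> y \<in> A \<Longrightarrow> x + y \<in> A" "x \<in> A \<Longrightarrow> y \<in> A \<Longrightarrow> x * y \<in> A" for a x y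
    using assms by (auto simp: finite_rank_subring_def)
  show "0 \<in> A" "1 \<in> A" using *(1)[of 0] *(1)[of 1] by (simp_all add: hom_zero hom_one)
  show "x \<in> A \<Longrightarrow> - x \<in> A" using *(3)[of "\<iota> (- 1)" x] *(1)[of "- 1"] by (simp add: hom_uminus hom_one)
qed

lemma algebraic_over_if_finite_rank:
  assumes "finite_rank_subring A" "x \<in> A"
  shows "algebraic_over x"
proof -
  have "x ^ k \<in> A" for k
    by (induction k) (use assms finite_rank_subringD[OF assms(1)] in auto)
  moreover obtain B where "finite B" "A \<subseteq> frac_span B"
    using assms(1) unfolding finite_rank_subring_def by blast
  ultimately show ?thesis by (intro algebraic_over_if_powers[of B]) auto
qed

lemma finite_rank_subring_base: "finite_rank_subring (range \<iota>)"
proof -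
  have "range \<iota> \<subseteq> frac_span {1}"
    using frac_span_scale[OF frac_span_base[of "{1}" 1]] by auto
  then show ?thesis
    unfolding finite_rank_subring_def
    by (auto simp flip: hom_add hom_mult)
qed

text \<open>The relation lowers \<open>r ^ k\<close> for \<open>k \<ge> d\<close> at the cost of the
  denominator \<open>m\<close>, so the rank grows at most by the factor \<open>d\<close>. With
  \<open>m\<close> in the base domain and the \<open>a i\<close> in \<open>A\<close>, it covers both
  elements algebraic over the base and roots of monic polynomials over \<open>A\<close>.\<close>

lemma finite_rank_subring_extend:
  assumes A: "finite_rank_subring A" and m: "m \<noteq> 0" and a: "\<And>i. i < d \<Longrightarrow> a i \<in> A"
    and r: "\<iota> m * r ^ d = (\<Sum>i<d. a i * r ^ i)"
  obtains A' where "finite_rank_subring A'" "A \<subseteq> A'" "r \<in> A'"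
proof -
  note AD = finite_rank_subringD[OF A]
  have A_sum: "(\<And>i. i \<in> I \<Longrightarrow> f i \<in> A) \<Longrightarrow> sum f I \<in> A" for f :: "nat \<Rightarrow> 'e" and I
    by (induction I rule: infinite_finite_induct) (use AD in auto)
  obtain B where B: "finite B" "A \<subseteq> frac_span B"
    using A unfolding finite_rank_subring_def by blast
  define B' where "B' = (\<lambda>(b, j). b * r ^ j) ` (B \<times> {..<d})"
  have fB': "finite B'" using B(1) by (simp add: B'_def)
  have low: "x * r ^ j \<in> frac_span B'" if "x \<in> A" "j < d" for x j
  proof -
    have "x \<in> frac_span B" using that(1) B(2) by auto
    then obtain n c where n: "n \<noteq> 0" "\<iota> n * x = (\<Sum>b\<in>B. \<iota> (c b) * b)"
      unfolding frac_span_def by blast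
    have "\<iota> n * (x * r ^ j) = (\<Sum>b\<in>B. \<iota> (c b) * (b * r ^ j))"
      using n(2) by (simp add: sum_distrib_right mult.assoc[symmetric])
    moreover have "\<dots> \<in> frac_span B'"
      using that(2) by (intro frac_span_sum frac_span_scale frac_span_base fB') (auto simp: B'_def)
    ultimately have "\<iota> n * (x * r ^ j) \<in> frac_span B'" by simp
    then show ?thesis using frac_span_divide n(1) by blast
  qed
  have all: "x * r ^ k \<in> frac_span B'" if "x \<in> A" for x k
    using that
  proof (induction k arbitrary: x rule: less_induct)
    case (less k)
    show ?case
    proof (cases "k < d")
      case True
      then show ?thesis using low less.prems by blast
    next
      case False
      have "\<iota> m * (x * r ^ k) = x * r ^ (k - d) * (\<iota> m * r ^ d)"
        using False by (simp add: mult_ac flip: power_add)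
      also have "\<dots> = (\<Sum>i<d. (x * a i) * r ^ (k - d + i))"
        by (simp add: r sum_distrib_left power_add mult_ac)
      also have "\<dots> \<in> frac_span B'"
        using False less.prems by (intro frac_span_sum less.IH AD a) auto
      finally show ?thesis using frac_span_divide m by blast
    qed
  qed
  define A' where "A' = {poly P r | P. \<forall>i. coeff P i \<in> A}"
  have A'I: "poly P r \<in> A'" if "\<And>i. coeff P i \<in> A" for P
    using that by (auto simp: A'_def)
  have sub: "A \<subseteq> A'"
  proof
    fix x assume "x \<in> A"
    then show "x \<in> A'" using A'I[of "[:x:]"] AD by (auto simp: coeff_pCons split: nat.splits)
  qed
  have "r \<in> A'" using A'I[of "[:0, 1:]"] AD by (auto simp: coeff_pCons split: nat.splits)
  moreover have "finite_rank_subring A'"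
    unfolding finite_rank_subring_def
  proof (intro conjI ballI exI[of _ B'])
    show "range \<iota> \<subseteq> A'" using sub AD(1) by auto
    fix x y assume "x \<in> A'" "y \<in> A'"
    then obtain P Q where P: "x = poly P r" "\<And>i. coeff P i \<in> A" "y = poly Q r" "\<And>i. coeff Q i \<in> A"
      by (auto simp: A'_def)
    show "x + y \<in> A'" using A'I[of "P + Q"] P AD by auto
    show "x * y \<in> A'"
      using A'I[of "P * Q"] P(1,3) A_sum AD(3)[OF P(2) P(4)] by (auto simp: coeff_mult)
  next
    show "finite B'" by fact
    show "A' \<subseteq> frac_span B'"
    proof
      fix x assume "x \<in> A'"
      then obtain P where P: "x = poly P r" "\<And>i. coeff P i \<in> A" by (auto simp: A'_def)
      show "x \<in> frac_span B'"
        unfolding P(1) poly_altdef by (intro frac_span_sum all P(2))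
    qed
  qed
  ultimately show ?thesis using that sub by blast
qed

lemma finite_rank_subring_extend_algebraic:
  assumes "finite_rank_subring A" "algebraic_over x"
  obtains A' where "finite_rank_subring A'" "A \<subseteq> A'" "x \<in> A'"
proof -
  obtain p where p: "p \<noteq> 0" "ev x p = 0" using assms(2) by (auto simp: algebraic_over_def)
  have "(\<Sum>i\<le>degree p. \<iota> (coeff p i) * x ^ i) = 0"
    using p(2) by (simp flip: ev_altdef)
  then have "\<iota> (lead_coeff p) * x ^ degree p = (\<Sum>i<degree p. \<iota> (- coeff p i) * x ^ i)"
    by (simp add: lessThan_Suc_atMost[symmetric] hom_uminus sum_negf eq_neg_iff_add_eq_0 add.commute)
  then show ?thesis
    using finite_rank_subring_extend[OF assms(1), of "lead_coeff p" "degree p" "\<lambda>i. \<iota> (- coeff p i)" x]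
      that p(1) finite_rank_subringD(1)[OF assms(1)] by auto
qed

lemma finite_rank_subring_exists:
  assumes "finite S" "\<And>x. x \<in> S \<Longrightarrow> algebraic_over x"
  obtains A where "finite_rank_subring A" "S \<subseteq> A"
proof -
  have "\<exists>A. finite_rank_subring A \<and> S \<subseteq> A"
    using assms
  proof (induction S rule: finite_induct)
    case empty
    then show ?case using finite_rank_subring_base by blast
  next
    case (insert x S)
    then obtain A where A: "finite_rank_subring A" "S \<subseteq> A" by auto
    obtain A' where "finite_rank_subring A'" "A \<subseteq> A'" "x \<in> A'"
      using finite_rank_subring_extend_algebraic[OF A(1), of x] insert.prems by auto
    then show ?case using A by blast
  qed
  then show ?thesis using that by blast
qed

lemma algebraic_over_hom: "algebraic_over (\<iota> a)"
  using algebraic_over_if_finite_rank finite_rank_subring_base by blast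

lemma algebraic_over_add_mult:
  assumes "algebraic_over x" "algebraic_over y"
  shows algebraic_over_add: "algebraic_over (x + y)"
    and algebraic_over_mult: "algebraic_over (x * y)"
proof -
  obtain A where A: "finite_rank_subring A" "{x, y} \<subseteq> A"
    using finite_rank_subring_exists[of "{x, y}"] assms by auto
  show "algebraic_over (x + y)" "algebraic_over (x * y)"
    using A finite_rank_subringD[OF A(1)] by (auto intro: algebraic_over_if_finite_rank[OF A(1)])
qed

lemma algebraic_over_uminus: "algebraic_over x \<Longrightarrow> algebraic_over (- x)"
  using algebraic_over_mult[of "\<iota> (- 1)" x] algebraic_over_hom[of "- 1"] by (simp add: hom_uminus hom_one)

lemma algebraic_over_diff: "algebraic_over x \<Longrightarrow> algebraic_over y \<Longrightarrow> algebraic_over (x - y)"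
  using algebraic_over_add[of x "- y"] algebraic_over_uminus by simp

lemma algebraic_over_power: "algebraic_over x \<Longrightarrow> algebraic_over (x ^ n)"
  by (induction n) (use algebraic_over_hom[of 1] algebraic_over_mult in \<open>auto simp: hom_one\<close>)

lemma algebraic_over_sum:
  "(\<And>i. i \<in> I \<Longrightarrow> algebraic_over (f i)) \<Longrightarrow> algebraic_over (sum f I)"
  by (induction I rule: infinite_finite_induct)
     (use algebraic_over_hom[of 0] algebraic_over_add in \<open>auto simp: hom_zero\<close>)

lemma algebraic_over_ev: "algebraic_over x \<Longrightarrow> algebraic_over (ev x p)"
  by (simp add: ev_altdef[OF order.refl] algebraic_over_sum algebraic_over_mult
      algebraic_over_hom algebraic_over_power)

lemma algebraic_over_root:
  assumes "\<And>i. i < d \<Longrightarrow> algebraic_over (a i)" and r: "r ^ d = (\<Sum>i<d. a i * r ^ i)"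
  shows "algebraic_over r"
proof -
  obtain A where A: "finite_rank_subring A" "a ` {..<d} \<subseteq> A"
    by (rule finite_rank_subring_exists[of "a ` {..<d}"]) (use assms(1) in auto)
  have "\<iota> 1 * r ^ d = (\<Sum>i<d. a i * r ^ i)" using r by (simp only: hom_one mult_1)
  then obtain A' where "finite_rank_subring A'" "r \<in> A'"
    by (rule finite_rank_subring_extend[OF A(1) one_neq_zero, rotated]) (use A(2) in auto)
  then show ?thesis using algebraic_over_if_finite_rank by blast
qed

text \<open>The reciprocal polynomial of \<open>p\<close> vanishes at \<open>y\<close>, and its
  constant coefficient is the leading coefficient of \<open>p\<close>.\<close>

lemma algebraic_over_inverse:
  assumes "algebraic_over x" "x * y = 1"
  shows "algebraic_over y"
proof -
  obtain p where p: "p \<noteq> 0" "ev x p = 0" using assms(1) by (auto simp: algebraic_over_def)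
  define n where "n = degree p"
  define q where "q = (\<Sum>i\<le>n. monom (coeff p i) (n - i))"
  have "coeff q 0 = (\<Sum>i\<le>n. if n - i = 0 then coeff p i else 0)"
    by (simp add: q_def coeff_sum)
  also have "\<dots> = (\<Sum>i\<le>n. if i = n then coeff p i else 0)"
    by (intro sum.cong) auto
  finally have "coeff q 0 \<noteq> 0" using p(1) by (simp add: n_def)
  then have q: "q \<noteq> 0" by auto
  have "ev y q = (\<Sum>i\<le>n. \<iota> (coeff p i) * x ^ i * y ^ n)"
    unfolding q_def ev_sum
  proof (intro sum.cong refl)
    fix i assume "i \<in> {..n}"
    then have "y ^ n = y ^ i * y ^ (n - i)" by (simp flip: power_add)
    then have "x ^ i * y ^ n = (x * y) ^ i * y ^ (n - i)" by (simp add: power_mult_distrib)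
    then show "ev y (monom (coeff p i) (n - i)) = \<iota> (coeff p i) * x ^ i * y ^ n"
      by (simp add: ev_monom assms(2) mult.assoc)
  qed
  also have "\<dots> = ev x p * y ^ n"
    by (simp add: ev_altdef[of p n] n_def sum_distrib_right)
  finally show ?thesis using p(2) q unfolding algebraic_over_def by auto
qed

text \<open>In a relation of least degree, a vanishing constant coefficient would allow cancelling
  \<open>x\<close>. The nonzero constant coefficient later bounds the points at which a function can
  vanish.\<close>

lemma algebraic_over_nonzero:
  assumes "algebraic_over x" "x \<noteq> 0"
  obtains p where "coeff p 0 \<noteq> 0" "ev x p = 0"
proof -
  have ex: "\<exists>p. p \<noteq> 0 \<and> ev x p = 0" using assms(1) by (simp add: algebraic_over_def)
  define p where "p = arg_min degree (\<lambda>p. p \<noteq> 0 \<and> ev x p = 0)"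
  have p: "p \<noteq> 0" "ev x p = 0" and min: "\<And>q. q \<noteq> 0 \<Longrightarrow> ev x q = 0 \<Longrightarrow> degree p \<le> degree q"
    using ex arg_min_natI[of "\<lambda>p. p \<noteq> 0 \<and> ev x p = 0" _ degree]
      arg_min_nat_le[of "\<lambda>p. p \<noteq> 0 \<and> ev x p = 0" _ degree]
    unfolding p_def by blast+
  have "coeff p 0 \<noteq> 0"
  proof
    assume 0: "coeff p 0 = 0"
    obtain a q where q: "p = pCons a q" by (cases p)
    with 0 have "p = pCons 0 q" by simp
    with p assms(2) have "q \<noteq> 0" "ev x q = 0" by (auto simp: ev_pCons hom_zero)
    with min[of q] \<open>p = pCons 0 q\<close> show False by (simp add: degree_pCons_eq)
  qed
  with p(2) that show ?thesis by blast
qed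

end

section \<open>Separability and primitive elements\<close>

interpretation ser: inj_coeff_hom "fps_of_poly :: 'a::field poly \<Rightarrow> 'a fps"
  by unfold_locales (simp_all add: fps_of_poly_add fps_of_poly_mult fps_of_poly_eq_iff[of _ 0, simplified])

interpretation ser2: inj_coeff_hom "map_poly fps_of_poly :: 'a::field poly poly \<Rightarrow> 'a fps poly"
proof -
  interpret coeff_hom "map_poly fps_of_poly :: 'a::field poly poly \<Rightarrow> 'a fps poly"
    by (rule ser.map_poly_coeff_hom)
  show "inj_coeff_hom (map_poly fps_of_poly :: 'a::field poly poly \<Rightarrow> 'a fps poly)"
    by unfold_locales (auto simp: poly_eq_iff coeff_map_poly dest: ser.hom_eq_0D)
qed

section \<open>Inverse Frobenius maps on polynomials and power series\<close>

text \<open>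
  For \<open>f \<in> K[t][Y]\<close> and \<open>w \<in> K[[t]]\<close>, \<open>ser.ev w f\<close> is \<open>f(t, w)\<close>; for \<open>\<chi> \<in> K[t][c][Y]\<close> and
  \<open>W \<in> K[[t]][c]\<close>, \<open>ser2.ev W \<chi>\<close> is \<open>\<chi>(t, c, W)\<close>.
\<close>

definition contract_poly :: "('b::zero \<Rightarrow> 'c::comm_monoid_add) \<Rightarrow> nat \<Rightarrow> 'b poly \<Rightarrow> 'c poly" where
  "contract_poly g p x = (\<Sum>j\<le>degree x. monom (g (coeff x (p * j))) j)"

lemma coeff_contract_poly:
  assumes "g 0 = 0" "p > 0"
  shows "coeff (contract_poly g p x) j = g (coeff x (p * j))"
proof -
  have "coeff (contract_poly g p x) j = (if j \<le> degree x then g (coeff x (p * j)) else 0)"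
    by (simp add: contract_poly_def coeff_sum)
  moreover have "degree x < p * j" if "degree x < j"
    using that assms(2) by (metis Suc_leI less_le_trans mult_1 mult_le_mono1 One_nat_def)
  ultimately show ?thesis using assms(1) by (auto simp: coeff_eq_0)
qed

lemma contract_poly_0: "g 0 = 0 \<Longrightarrow> contract_poly g p 0 = 0"
  by (simp add: contract_poly_def)

definition contract_fps :: "('b::zero \<Rightarrow> 'c::zero) \<Rightarrow> nat \<Rightarrow> 'b fps \<Rightarrow> 'c fps" where
  "contract_fps g p x = Abs_fps (\<lambda>n. g (x $ (p * n)))"

lemma sum_multiples:
  fixes f :: "nat \<Rightarrow> 'b::comm_monoid_add"
  assumes "p > 0" "\<And>i. \<not> p dvd i \<Longrightarrow> f i = 0"
  shows "(\<Sum>i\<le>p * n. f i) = (\<Sum>i\<le>n. f (p * i))"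
proof -
  have "(\<Sum>i\<le>n. f (p * i)) = (\<Sum>i\<in>(*) p ` {..n}. f i)"
    using assms(1) by (subst sum.reindex) (auto simp: inj_on_def)
  also have "\<dots> = (\<Sum>i\<le>p * n. f i)"
  proof (intro sum.mono_neutral_left ballI)
    fix i assume i: "i \<in> {..p * n} - (*) p ` {..n}"
    have "\<not> p dvd i"
    proof
      assume "p dvd i"
      then obtain k where "i = p * k" by auto
      with i assms(1) show False by auto
    qed
    then show "f i = 0" by (rule assms(2))
  qed auto
  finally show ?thesis ..
qed

lemma coeff_power_char:
  fixes y :: "'b::idom poly"
  assumes p: "p = CHAR('b)" "p > 0"
  shows "coeff (y ^ p) j = (if p dvd j then coeff y (j div p) ^ p else 0)"
proof (induction y arbitrary: j)
  case 0
  then show ?case using p(2) by (simp add: power_0_left)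
next
  case (pCons a y)
  have pr: "prime p" using p by (simp add: prime_CHAR_semidom)
  have "pCons a y = [:a:] + [:0, 1:] * y" by simp
  then have "pCons a y ^ p = [:a:] ^ p + ([:0, 1:] * y) ^ p"
    using pr p(1) by (simp only: freshmans_dream semiring_char_poly)
  also have "\<dots> = [:a ^ p:] + monom 1 p * y ^ p"
    by (subst power_mult_distrib) (simp add: poly_const_pow monom_altdef)
  finally have *: "coeff (pCons a y ^ p) j = coeff [:a ^ p:] j + (if j < p then 0 else coeff (y ^ p) (j - p))"
    by (simp add: coeff_monom_mult)
  show ?case
  proof (cases "j < p")
    case True
    then show ?thesis using p(2) * by (cases "j = 0") (auto simp: coeff_pCons split: nat.splits)
  next
    case False
    then have "j > 0" "p dvd (j - p) \<longleftrightarrow> p dvd j" "j div p = Suc ((j - p) div p)"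
      using p(2) by (auto simp: le_div_geq dvd_minus_self)
    then show ?thesis using False by (simp add: * pCons.IH coeff_pCons split: nat.splits)
  qed
qed

lemma fps_nth_power_char:
  fixes y :: "'b::idom fps"
  assumes p: "p = CHAR('b)" "p > 0"
  shows "(y ^ p) $ j = (if p dvd j then (y $ (j div p)) ^ p else 0)"
proof (induction j arbitrary: y rule: less_induct)
  case (less j)
  have pr: "prime p" using p by (simp add: prime_CHAR_semidom)
  have "y = fps_const (y $ 0) + fps_X * fps_shift 1 y"
    by (intro fps_ext) auto
  then have "y ^ p = (fps_const (y $ 0) + fps_X * fps_shift 1 y) ^ p" by simp
  also have "\<dots> = fps_const (y $ 0) ^ p + (fps_X * fps_shift 1 y) ^ p"
    using pr p(1) by (simp only: freshmans_dream semiring_char_fps)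
  also have "\<dots> = fps_const ((y $ 0) ^ p) + fps_X ^ p * fps_shift 1 y ^ p"
    by (simp add: power_mult_distrib fps_const_power)
  finally have *: "(y ^ p) $ j = (if j = 0 then (y $ 0) ^ p else 0) +
      (if j < p then 0 else (fps_shift 1 y ^ p) $ (j - p))"
    by (simp add: fps_X_power_mult_nth)
  show ?case
  proof (cases "j < p")
    case True
    then show ?thesis using p(2) * by (cases "j = 0") auto
  next
    case False
    then have "j > 0" "p dvd (j - p) \<longleftrightarrow> p dvd j" "j div p = Suc ((j - p) div p)"
      using p(2) by (auto simp: le_div_geq dvd_minus_self)
    then show ?thesis using False p(2) by (simp add: * less.IH)
  qed
qed

text \<open>The action \<open>x ^ p * a\<close> makes the field a vector space over itself, in
  effect over its subfield of p-th powers, and \<open>\<theta>\<close> is a linear functional for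
  it. It replaces the p-th root, which need not exist over an imperfect field, and is chosen not to
  kill a prescribed coefficient.\<close>

lemma inverse_frobenius_linear_exists:
  fixes a0 :: "'a::field"
  assumes p: "p = CHAR('a)" "p > 0" and "a0 \<noteq> 0"
  obtains \<theta> :: "'a \<Rightarrow> 'a" where "\<And>a b. \<theta> (a + b) = \<theta> a + \<theta> b"
    "\<And>x a. \<theta> (x ^ p * a) = x * \<theta> a" "\<theta> a0 \<noteq> 0"
proof -
  have pr: "prime p" using p by (simp add: prime_CHAR_semidom)
  interpret vector_space_pair "\<lambda>x a :: 'a. x ^ p * a" "(*) :: 'a \<Rightarrow> 'a \<Rightarrow> 'a"
    using pr p by unfold_locales (auto simp: algebra_simps freshmans_dream power_mult_distrib)
  have "vs1.independent {a0}" using assms(3) by simp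
  from linear_independent_extend[OF this, of "\<lambda>_. 1"] obtain \<theta>
    where \<theta>: "Vector_Spaces.linear (\<lambda>x a. x ^ p * a) (*) \<theta>" "\<theta> a0 = 1" by auto
  interpret \<theta>: Vector_Spaces.linear "\<lambda>x a. x ^ p * a" "(*)" \<theta> by (rule \<theta>(1))
  show ?thesis
    by (rule that[of \<theta>]) (use \<theta>.add \<theta>.scale \<theta>(2) in auto)
qed

context
  fixes \<theta> :: "'a::field \<Rightarrow> 'a" and p :: nat
  assumes p: "p = CHAR('a)" "p > 0"
    and \<theta>_add: "\<And>a b. \<theta> (a + b) = \<theta> a + \<theta> b"
    and \<theta>_mult: "\<And>x a. \<theta> (x ^ p * a) = x * \<theta> a"
begin

lemma \<theta>_0: "\<theta> 0 = 0"
  using \<theta>_mult[of 0 0] by simp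

lemma \<theta>_sum: "\<theta> (sum f A) = (\<Sum>x\<in>A. \<theta> (f x))"
  by (induction A rule: infinite_finite_induct) (simp_all add: \<theta>_0 \<theta>_add)

lemma contract_fps_add: "contract_fps \<theta> p (x + y) = contract_fps \<theta> p x + contract_fps \<theta> p y"
  by (intro fps_ext) (simp add: contract_fps_def \<theta>_add)

lemma contract_fps_0: "contract_fps \<theta> p 0 = 0"
  by (intro fps_ext) (simp add: contract_fps_def \<theta>_0)

lemma contract_fps_sum: "contract_fps \<theta> p (sum f A) = (\<Sum>x\<in>A. contract_fps \<theta> p (f x))"
  by (induction A rule: infinite_finite_induct) (simp_all add: contract_fps_0 contract_fps_add)

text \<open>Together with additivity this is p^{-1}-linearity, so contraction is an operator of
  Cartier type. As \<open>y ^ p\<close> lives in degrees divisible by \<open>p\<close>, the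
  coefficient \<open>p * n\<close> of the product sees only coefficients of \<open>x\<close> at
  multiples of \<open>p\<close>.\<close>

lemma contract_fps_mult: "contract_fps \<theta> p (y ^ p * x) = y * contract_fps \<theta> p x"
proof (intro fps_ext)
  fix n
  have "(y ^ p * x) $ (p * n) = (\<Sum>i\<le>p * n. (y ^ p) $ i * x $ (p * n - i))"
    by (simp add: fps_mult_nth atLeast0AtMost)
  also have "\<dots> = (\<Sum>i\<le>n. (y $ i) ^ p * x $ (p * (n - i)))"
    using p(2) by (subst sum_multiples) (auto simp: fps_nth_power_char[OF p] diff_mult_distrib2)
  finally have "\<theta> ((y ^ p * x) $ (p * n)) = (\<Sum>i\<le>n. y $ i * \<theta> (x $ (p * (n - i))))"
    by (simp only: \<theta>_sum \<theta>_mult)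
  then show "contract_fps \<theta> p (y ^ p * x) $ n = (y * contract_fps \<theta> p x) $ n"
    by (simp add: contract_fps_def fps_mult_nth[of y] atLeast0AtMost)
qed

lemma contract_poly_fps_mult:
  "contract_poly (contract_fps \<theta> p) p (y ^ p * x) = y * contract_poly (contract_fps \<theta> p) p x"
proof (intro poly_eqI)
  fix n
  have p': "p = CHAR('a fps)" using p(1) by simp
  have "coeff (y ^ p * x) (p * n) = (\<Sum>i\<le>p * n. coeff (y ^ p) i * coeff x (p * n - i))"
    by (simp add: coeff_mult)
  also have "\<dots> = (\<Sum>i\<le>n. coeff y i ^ p * coeff x (p * (n - i)))"
    using p(2) by (subst sum_multiples) (auto simp: coeff_power_char[OF p' p(2)] diff_mult_distrib2)
  finally show "coeff (contract_poly (contract_fps \<theta> p) p (y ^ p * x)) n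
      = coeff (y * contract_poly (contract_fps \<theta> p) p x) n"
    by (simp add: coeff_contract_poly contract_fps_0 p(2) coeff_mult contract_fps_sum contract_fps_mult)
qed

lemma contract_poly_fps_add:
  "contract_poly (contract_fps \<theta> p) p (x + y) =
   contract_poly (contract_fps \<theta> p) p x + contract_poly (contract_fps \<theta> p) p y"
  by (intro poly_eqI) (simp add: coeff_contract_poly contract_fps_0 p(2) contract_fps_add)

lemma contract_poly_fps_sum:
  "contract_poly (contract_fps \<theta> p) p (sum f A) = (\<Sum>x\<in>A. contract_poly (contract_fps \<theta> p) p (f x))"
  by (induction A rule: infinite_finite_induct)
     (simp_all add: contract_poly_fps_add contract_poly_0 contract_fps_0)

lemma contract_poly_hom:
  "contract_poly (contract_fps \<theta> p) p (map_poly fps_of_poly q) =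
   map_poly fps_of_poly (contract_poly (contract_poly \<theta> p) p q)"
proof (intro poly_eqI fps_ext)
  fix j n
  have "coeff (contract_poly (contract_fps \<theta> p) p (map_poly fps_of_poly q)) j $ n
      = contract_fps \<theta> p (fps_of_poly (coeff q (p * j))) $ n"
    by (simp add: coeff_contract_poly contract_fps_0 p(2) coeff_map_poly)
  then show "coeff (contract_poly (contract_fps \<theta> p) p (map_poly fps_of_poly q)) j $ n =
      coeff (map_poly fps_of_poly (contract_poly (contract_poly \<theta> p) p q)) j $ n"
    by (simp add: coeff_contract_poly contract_poly_0 \<theta>_0 p(2) coeff_map_poly contract_fps_def)
qed

text \<open>Each power \<open>W ^ (p * k)\<close> is the p-th power of \<open>W ^ k\<close> and
  leaves the contraction as \<open>W ^ k\<close>. Hence contracting a relation in all three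
  variables gives a relation for the same \<open>W\<close>.\<close>

lemma ev_contract_poly:
  assumes "\<And>k. \<not> p dvd k \<Longrightarrow> coeff \<chi> k = 0"
  shows "ser2.ev W (contract_poly (contract_poly (contract_poly \<theta> p) p) p \<chi>) =
    contract_poly (contract_fps \<theta> p) p (ser2.ev W \<chi>)"
proof -
  let ?S = "contract_poly (contract_poly \<theta> p) p"
  let ?T = "contract_poly (contract_fps \<theta> p) p"
  have S0: "?S 0 = 0" by (simp add: contract_poly_0 \<theta>_0)
  define n where "n = degree \<chi>"
  have "degree \<chi> \<le> p * n" using p(2) by (simp add: n_def)
  then have "ser2.ev W \<chi> = (\<Sum>k\<le>p * n. map_poly fps_of_poly (coeff \<chi> k) * W ^ k)"
    by (rule ser2.ev_altdef)
  also have "\<dots> = (\<Sum>k\<le>n. map_poly fps_of_poly (coeff \<chi> (p * k)) * W ^ (p * k))"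
    using p(2) assms by (intro sum_multiples) auto
  also have "\<dots> = (\<Sum>k\<le>n. (W ^ k) ^ p * map_poly fps_of_poly (coeff \<chi> (p * k)))"
    by (simp add: mult.commute flip: power_mult)
  finally have "?T (ser2.ev W \<chi>) = (\<Sum>k\<le>n. map_poly fps_of_poly (?S (coeff \<chi> (p * k))) * W ^ k)"
    by (simp add: contract_poly_fps_sum contract_poly_fps_mult contract_poly_hom mult.commute)
  moreover have "degree (contract_poly ?S p \<chi>) \<le> n"
    unfolding contract_poly_def[of ?S p \<chi>] n_def
    by (intro degree_sum_le) (auto intro: order.trans[OF degree_monom_le])
  then have "ser2.ev W (contract_poly ?S p \<chi>) =
      (\<Sum>k\<le>n. map_poly fps_of_poly (coeff (contract_poly ?S p \<chi>) k) * W ^ k)"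
    by (rule ser2.ev_altdef)
  ultimately show ?thesis using S0 p(2) by (simp add: coeff_contract_poly)
qed

end

text \<open>The degree in \<open>Y\<close>, \<open>c\<close> and \<open>t\<close> together: each of
  the three partial derivatives lowers it, and contraction divides it by \<open>p\<close>.\<close>

definition bounded_total_degree :: "'a::zero poly poly poly \<Rightarrow> nat \<Rightarrow> bool" where
  "bounded_total_degree \<chi> N \<longleftrightarrow>
     (\<forall>k l i. coeff (coeff (coeff \<chi> k) l) i \<noteq> 0 \<longrightarrow> k + l + i \<le> N)"

lemma bounded_total_degree_exists: "\<exists>N. bounded_total_degree \<chi> N"
proof -
  let ?f = "\<lambda>k l i. coeff (coeff (coeff \<chi> k) l) i"
  let ?M = "Max ((\<lambda>k. degree (coeff \<chi> k)) ` {..degree \<chi>})"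
  let ?R = "Max ((\<lambda>(k, l). degree (coeff (coeff \<chi> k) l)) ` ({..degree \<chi>} \<times> {..?M}))"
  have "k + l + i \<le> degree \<chi> + ?M + ?R" if "?f k l i \<noteq> 0" for k l i
  proof -
    have k: "k \<le> degree \<chi>" using that by (auto intro: le_degree)
    have "l \<le> degree (coeff \<chi> k)" using that by (auto intro: le_degree)
    also have "\<dots> \<le> ?M" using k by (intro Max_ge) auto
    finally have l: "l \<le> ?M" .
    have "i \<le> degree (coeff (coeff \<chi> k) l)" using that by (auto intro: le_degree)
    also have "\<dots> \<le> ?R" using k l by (intro Max_ge) auto
    finally show ?thesis using k l by linarith
  qed
  then show ?thesis unfolding bounded_total_degree_def by blast
qed

text \<open>
  A relation of minimal total degree is separable: otherwise all its partial derivatives vanish, so it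
  is a polynomial in \<open>p\<close>-th powers, and a \<open>p\<close>-th root of it, taken after applying an inverse-Frobenius
  linear functional to the coefficients, is a smaller relation.
\<close>

lemma separable_relation_exists:
  fixes W :: "'a::field fps poly"
  assumes "ser2.algebraic_over W"
  obtains \<chi> where "ser2.ev W \<chi> = 0" "ser2.ev W (pderiv \<chi>) \<noteq> 0"
proof -
  define P where "P N \<longleftrightarrow> (\<exists>\<chi>. \<chi> \<noteq> 0 \<and> ser2.ev W \<chi> = 0 \<and> bounded_total_degree \<chi> N)" for N
  have "\<exists>N. P N"
    using assms bounded_total_degree_exists unfolding P_def ser2.algebraic_over_def by blast
  then obtain N where N: "P N" and least: "\<And>M. M < N \<Longrightarrow> \<not> P M"
    using exists_least_iff[of P] by auto
  from N obtain \<chi> where \<chi>: "\<chi> \<noteq> 0" "ser2.ev W \<chi> = 0" "bounded_total_degree \<chi> N"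
    by (auto simp: P_def)
  have min: "\<xi> = 0" if "ser2.ev W \<xi> = 0" "bounded_total_degree \<xi> M" "M < N" for \<xi> M
    using least[OF that(3)] that(1,2) by (auto simp: P_def)
  have not0: "\<not> bounded_total_degree \<chi> 0"
  proof
    assume *: "bounded_total_degree \<chi> 0"
    have "coeff \<chi> k = 0" if "k > 0" for k
      using * that unfolding bounded_total_degree_def by (intro poly_eqI) force
    then have "\<chi> = [:coeff \<chi> 0:]"
      by (intro poly_eqI) (auto simp: coeff_pCons split: nat.splits)
    with \<chi>(1,2) show False by (metis ser2.ev_const ser2.hom_eq_0D pCons_eq_0_iff)
  qed
  with \<chi>(3) have N0: "N > 0" by (cases N) auto
  define c where "c k l i = coeff (coeff (coeff \<chi> k) l) i" for k l i
  have c: "k + l + i \<le> N" if "c k l i \<noteq> 0" for k l i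
    using \<chi>(3) that unfolding bounded_total_degree_def c_def by blast
  have "ser2.ev W (pderiv \<chi>) \<noteq> 0"
  proof
    assume 0: "ser2.ev W (pderiv \<chi>) = 0"
    have coeffs:
      "coeff (coeff (coeff (pderiv \<chi>) k) l) i = of_nat (Suc k) * c (Suc k) l i"
      "coeff (coeff (coeff (map_poly pderiv \<chi>) k) l) i = of_nat (Suc l) * c k (Suc l) i"
      "coeff (coeff (coeff (map_poly (map_poly pderiv) \<chi>) k) l) i = of_nat (Suc i) * c k l (Suc i)"
      for k l i
      by (simp_all add: coeff_pderiv coeff_map_poly of_nat_poly c_def del: of_nat_Suc)
    have Y: "pderiv \<chi> = 0"
      by (rule min[OF 0, of "N - 1"])
         (use N0 c in \<open>auto simp: bounded_total_degree_def coeffs simp del: of_nat_Suc dest!: c\<close>)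
    \<comment> \<open>As both \<open>\<chi>\<close> and its \<open>Y\<close>-derivative vanish at
      \<open>W\<close>, the chain rule leaves only the \<open>c\<close>-derivative of
      \<open>\<chi>\<close> at \<open>W\<close>. It is a relation of smaller degree, hence zero; the
      same works for \<open>t\<close>.\<close>
    have "pderiv (ser2.ev W \<chi>) = ser2.ev W (map_poly pderiv \<chi>) + ser2.ev W (pderiv \<chi>) * pderiv W"
      by (rule ser2.derivation_ev) (auto simp: pderiv_add pderiv_mult ser.map_poly_pderiv)
    then have C: "map_poly pderiv \<chi> = 0"
      by (intro min[of _ "N - 1"])
         (use N0 c in \<open>auto simp: 0 \<chi>(2) bounded_total_degree_def coeffs simp del: of_nat_Suc dest!: c\<close>)
    have map_deriv_mult: "map_poly fps_deriv (x * y) = x * map_poly fps_deriv y + map_poly fps_deriv x * y"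
      for x y :: "'a fps poly"
      by (intro poly_eqI) (simp add: coeff_map_poly coeff_mult fps_deriv_sum sum.distrib)
    have "map_poly fps_deriv (ser2.ev W \<chi>) = ser2.ev W (map_poly (map_poly pderiv) \<chi>)
        + ser2.ev W (pderiv \<chi>) * map_poly fps_deriv W"
      by (rule ser2.derivation_ev)
         (auto simp: map_deriv_mult poly_eq_iff coeff_map_poly fps_of_poly_pderiv)
    then have T: "map_poly (map_poly pderiv) \<chi> = 0"
      by (intro min[of _ "N - 1"])
         (use N0 c in \<open>auto simp: 0 \<chi>(2) bounded_total_degree_def coeffs simp del: of_nat_Suc dest!: c\<close>)
    have char: "CHAR('a) dvd k \<and> CHAR('a) dvd l \<and> CHAR('a) dvd i" if "c k l i \<noteq> 0" for k l i
    proof -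
      have "of_nat k * c k l i = 0" "of_nat l * c k l i = 0" "of_nat i * c k l i = 0"
        using coeffs(1)[of "k - 1" l i] coeffs(2)[of k "l - 1" i] coeffs(3)[of k l "i - 1"]
        by (cases k; cases l; cases i; simp add: Y C T)+
      with that show ?thesis by (simp add: of_nat_eq_0_iff_char_dvd)
    qed
    define p where "p = CHAR('a)"
    \<comment> \<open>In characteristic 0, divisibility by \<open>CHAR('a) = 0\<close> forces all
      exponents to be 0, so \<open>\<chi>\<close> would be a constant.\<close>
    have "p > 0"
    proof (rule ccontr)
      assume "\<not> p > 0"
      with char have "bounded_total_degree \<chi> 0"
        by (auto simp: bounded_total_degree_def p_def c_def)
      with not0 show False by blast
    qed
    then have "p \<ge> 2" using prime_CHAR_semidom[where ?'a = 'a] by (simp add: p_def prime_ge_2_nat)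
    obtain k l i where kli: "c k l i \<noteq> 0"
      using \<chi>(1) by (auto simp: poly_eq_iff c_def)
    obtain \<theta> :: "'a \<Rightarrow> 'a" where \<theta>: "\<And>a b. \<theta> (a + b) = \<theta> a + \<theta> b"
      "\<And>x a. \<theta> (x ^ p * a) = x * \<theta> a" "\<theta> (c k l i) \<noteq> 0"
      using inverse_frobenius_linear_exists[OF p_def \<open>p > 0\<close> kli] by blast
    \<comment> \<open>\<open>Q\<close> has the bound \<open>N div p\<close>, yet it is nonzero:
      \<open>\<theta>\<close> does not vanish at the coefficient with indices \<open>k\<close>,
      \<open>l\<close>, \<open>i\<close>, which are all multiples of \<open>p\<close>.\<close>
    define Q where "Q = contract_poly (contract_poly (contract_poly \<theta> p) p) p \<chi>"
    have \<theta>0: "\<theta> 0 = 0" using \<theta>(2)[of 0 0] by simp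
    have Q: "coeff (coeff (coeff Q k) l) i = \<theta> (c (p * k) (p * l) (p * i))" for k l i
      by (simp add: Q_def coeff_contract_poly contract_poly_0 \<theta>0 \<open>p > 0\<close> c_def)
    have "ser2.ev W Q = contract_poly (contract_fps \<theta> p) p (ser2.ev W \<chi>)"
      unfolding Q_def
    proof (rule ev_contract_poly[OF p_def \<open>p > 0\<close> \<theta>(1,2)])
      fix k assume "\<not> p dvd k"
      then show "coeff \<chi> k = 0"
        using char unfolding c_def p_def by (intro poly_eqI) force
    qed
    also have "\<dots> = 0" using \<chi>(2) by (simp add: contract_poly_def contract_fps_def \<theta>0 fps_eq_iff)
    finally have "ser2.ev W Q = 0" .
    moreover have "bounded_total_degree Q (N div p)"
      unfolding bounded_total_degree_def
    proof (intro allI impI)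
      fix k l i assume "coeff (coeff (coeff Q k) l) i \<noteq> 0"
      then have "c (p * k) (p * l) (p * i) \<noteq> 0" by (auto simp: Q \<theta>0)
      from c[OF this] have "p * (k + l + i) \<le> N" by (simp add: algebra_simps)
      then show "k + l + i \<le> N div p"
        using \<open>p > 0\<close> by (simp add: less_eq_div_iff_mult_less_eq mult.commute)
    qed
    moreover have "N div p < N" using N0 \<open>p \<ge> 2\<close> by simp
    ultimately have "Q = 0" by (rule min)
    moreover have "k = p * (k div p)" "l = p * (l div p)" "i = p * (i div p)"
      using char[OF kli] by (auto simp: p_def)
    ultimately show False using Q[of "k div p" "l div p" "i div p"] \<theta>(3) by simp
  qed
  with \<chi>(2) that show ?thesis by blast
qed

section \<open>Primitive elements for algebraic power series\<close>

lemma ser2_algebraic_const: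
  assumes "ser.algebraic_over z"
  shows "ser2.algebraic_over [:z:]"
proof -
  obtain f where f: "f \<noteq> 0" "ser.ev z f = 0" using assms by (auto simp: ser.algebraic_over_def)
  have "ser2.ev [:z:] (map_poly (\<lambda>r. [:r:]) p) = [:ser.ev z p:]" for p
    by (induction p) (simp_all add: map_poly_pCons ser.ev_pCons ser2.ev_pCons)
  moreover have "map_poly (\<lambda>r. [:r:]) f \<noteq> 0"
    using f(1) by (simp add: map_poly_eq_0_iff)
  ultimately show ?thesis using f(2) by (auto simp: ser2.algebraic_over_def)
qed

text \<open>The power series that belong to the field K(t, w).\<close>

definition rational_over :: "'a::field fps \<Rightarrow> 'a fps set" where
  "rational_over w = {\<alpha>. \<exists>q h. ser.ev w q \<noteq> 0 \<and> ser.ev w q * \<alpha> = ser.ev w h}"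

lemma rational_overI: "ser.ev w q \<noteq> 0 \<Longrightarrow> ser.ev w q * \<alpha> = ser.ev w h \<Longrightarrow> \<alpha> \<in> rational_over w"
  by (auto simp: rational_over_def)

lemma rational_over_ev_self: "ser.ev w h \<in> rational_over w"
  by (rule rational_overI[of _ 1]) auto

lemma rational_over_add_mult:
  assumes "x \<in> rational_over w" "y \<in> rational_over w"
  shows rational_over_add: "x + y \<in> rational_over w"
    and rational_over_mult: "x * y \<in> rational_over w"
proof -
  obtain q h q' h' where *: "ser.ev w q \<noteq> 0" "ser.ev w q * x = ser.ev w h"
    "ser.ev w q' \<noteq> 0" "ser.ev w q' * y = ser.ev w h'"
    using assms by (auto simp: rational_over_def)
  have "ser.ev w (q * q') * (x + y) = ser.ev w q' * (ser.ev w q * x) + ser.ev w q * (ser.ev w q' * y)"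
    by (simp add: ser.ev_mult algebra_simps)
  then show "x + y \<in> rational_over w"
    using * by (intro rational_overI[of w "q * q'" _ "q' * h + q * h'"]) (auto simp: ser.ev_mult ser.ev_add)
  have "ser.ev w (q * q') * (x * y) = (ser.ev w q * x) * (ser.ev w q' * y)"
    by (simp add: ser.ev_mult algebra_simps)
  then show "x * y \<in> rational_over w"
    using * by (intro rational_overI[of w "q * q'" _ "h * h'"]) (auto simp: ser.ev_mult)
qed

lemma rational_over_divide:
  assumes "x \<in> rational_over w" "y \<in> rational_over w" "x \<noteq> 0" "x * u = y"
  shows "u \<in> rational_over w"
proof -
  obtain q h q' h' where *: "ser.ev w q \<noteq> 0" "ser.ev w q * x = ser.ev w h"
    "ser.ev w q' \<noteq> 0" "ser.ev w q' * y = ser.ev w h'"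
    using assms by (auto simp: rational_over_def)
  have "ser.ev w (h * q') * u = ser.ev w q * (ser.ev w q' * (x * u))"
    unfolding ser.ev_mult *(2)[symmetric] by (simp add: algebra_simps)
  also have "\<dots> = ser.ev w (q * h')"
    unfolding assms(4) *(4) ser.ev_mult ..
  finally have "ser.ev w (h * q') * u = ser.ev w (q * h')" .
  moreover have "ser.ev w (h * q') \<noteq> 0"
    using *(1,3) assms(3) unfolding ser.ev_mult *(2)[symmetric] by simp
  ultimately show ?thesis by (rule rational_overI[rotated])
qed

lemma rational_over_ev: "z \<in> rational_over w \<Longrightarrow> ser.ev z p \<in> rational_over w"
proof (induction p)
  case 0
  then show ?case using rational_over_ev_self[of w 0] by simp
next
  case (pCons a p)
  then show ?case
    using rational_over_ev_self[of w "[:a:]"]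
    by (simp add: ser.ev_pCons rational_over_add rational_over_mult)
qed

lemma rational_over_trans:
  assumes "\<alpha> \<in> rational_over z" "z \<in> rational_over w"
  shows "\<alpha> \<in> rational_over w"
proof -
  obtain q h where "ser.ev z q \<noteq> 0" "ser.ev z q * \<alpha> = ser.ev z h"
    using assms(1) by (auto simp: rational_over_def)
  then show ?thesis using rational_over_divide rational_over_ev[OF assms(2)] by blast
qed

lemma ev_specialize:
  "ser.ev (poly W (fps_const c)) (map_poly (\<lambda>q. poly q [:c:]) \<chi>) = poly (ser2.ev W \<chi>) (fps_const c)"
proof -
  have *: "fps_of_poly (poly q [:c:]) = poly (map_poly fps_of_poly q) (fps_const c)" for q
    by (induction q) (simp_all add: fps_of_poly_add fps_of_poly_mult map_poly_pCons fps_of_poly_const fps_of_poly_smult)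
  show ?thesis
    by (induction \<chi>) (simp_all add: map_poly_pCons ser.ev_pCons ser2.ev_pCons *)
qed

text \<open>
  Differentiating a relation \<open>\<chi>(t, c, z + c r) = 0\<close> with respect to the indeterminate \<open>c\<close> expresses
  \<open>r\<close> rationally in \<open>z + c r\<close>; then \<open>c\<close> is specialised to a constant.
\<close>

lemma primitive_element:
  fixes z r :: "'a::field fps"
  assumes inf: "infinite (UNIV :: 'a set)" and "ser.algebraic_over z" "ser.algebraic_over r"
  obtains w f where "ser.ev w f = 0" "ser.ev w (pderiv f) \<noteq> 0"
    "z \<in> rational_over w" "r \<in> rational_over w"
proof -
  define W where "W = [:z, r:]"
  have "W = [:z:] + map_poly fps_of_poly [:0, 1:] * [:r:]"
    by (simp add: W_def map_poly_pCons)
  then have "ser2.algebraic_over W"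
    using assms by (simp only: ser2.algebraic_over_add ser2.algebraic_over_mult
        ser2.algebraic_over_hom ser2_algebraic_const)
  then obtain \<chi> where \<chi>: "ser2.ev W \<chi> = 0" "ser2.ev W (pderiv \<chi>) \<noteq> 0"
    by (rule separable_relation_exists)
  have "pderiv (ser2.ev W \<chi>) = ser2.ev W (map_poly pderiv \<chi>) + ser2.ev W (pderiv \<chi>) * pderiv W"
    by (rule ser2.derivation_ev) (auto simp: pderiv_add pderiv_mult ser.map_poly_pderiv)
  moreover have pderiv_W: "pderiv W = [:r:]" by (simp add: W_def pderiv_pCons)
  ultimately have \<chi>c: "ser2.ev W (map_poly pderiv \<chi>) + ser2.ev W (pderiv \<chi>) * [:r:] = 0"
    using \<chi>(1) pderiv_W by simp
  \<comment> \<open>The specialised relation has to stay separable. Its \<open>Y\<close>-derivative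
    at \<open>W\<close> is a nonzero polynomial in \<open>c\<close> over K[[t]], so all but finitely
    many constants of the infinite field K will do.\<close>
  have "finite {x. poly (ser2.ev W (pderiv \<chi>)) x = 0}"
    using \<chi>(2) by (rule poly_roots_finite)
  moreover have "infinite (range (fps_const :: 'a \<Rightarrow> 'a fps))"
    using inf by (subst finite_image_iff) (auto simp: inj_on_def)
  ultimately have "\<not> range (fps_const :: 'a \<Rightarrow> 'a fps) \<subseteq> {x. poly (ser2.ev W (pderiv \<chi>)) x = 0}"
    using finite_subset by blast
  then obtain c where c: "poly (ser2.ev W (pderiv \<chi>)) (fps_const c) \<noteq> 0" by blast
  define w where "w = poly W (fps_const c)"
  define S where "S = map_poly (\<lambda>q. poly q [:c:])"
  interpret S: coeff_hom "\<lambda>q. poly q [:c:]" by unfold_locales auto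
  have ev: "ser.ev w (S \<xi>) = poly (ser2.ev W \<xi>) (fps_const c)" for \<xi>
    by (simp add: w_def S_def ev_specialize)
  have w: "w = z + fps_const c * r" by (simp add: w_def W_def)
  have 1: "ser.ev w (S \<chi>) = 0" by (simp add: ev \<chi>(1))
  have 2: "ser.ev w (pderiv (S \<chi>)) \<noteq> 0"
    using c by (simp add: ev S_def flip: S.map_poly_pderiv) (simp add: ev flip: S_def)
  have "poly (ser2.ev W (map_poly pderiv \<chi>) + ser2.ev W (pderiv \<chi>) * [:r:]) (fps_const c) = 0"
    by (simp only: \<chi>c poly_0)
  then have "ser.ev w (S (map_poly pderiv \<chi>)) + ser.ev w (S (pderiv \<chi>)) * r = 0"
    by (simp add: ev mult.commute)
  then have "ser.ev w (S (pderiv \<chi>)) * r = ser.ev w (- S (map_poly pderiv \<chi>))"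
    by (simp add: ser.ev_uminus eq_neg_iff_add_eq_0 add.commute)
  moreover have "ser.ev w (S (pderiv \<chi>)) \<noteq> 0" using c by (simp add: ev)
  ultimately have r: "r \<in> rational_over w" by (intro rational_overI)
  have "z = ser.ev w [:0, 1:] + ser.ev w [:[:- c:]:] * r"
    by (simp add: ser.ev_pCons w fps_of_poly_const flip: fps_const_neg)
  then have "z \<in> rational_over w"
    using r by (metis rational_over_add rational_over_mult rational_over_ev_self)
  with 1 2 r that show ?thesis by blast
qed

lemma primitive_element_finite:
  fixes S :: "'a::field fps set"
  assumes inf: "infinite (UNIV :: 'a set)" and "finite S" "\<And>x. x \<in> S \<Longrightarrow> ser.algebraic_over x"
  obtains w f where "ser.ev w f = 0" "ser.ev w (pderiv f) \<noteq> 0" "S \<subseteq> rational_over w"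
proof -
  have "\<exists>w f. ser.ev w f = 0 \<and> ser.ev w (pderiv f) \<noteq> 0 \<and> S \<subseteq> rational_over w"
    using assms(2,3)
  proof (induction S rule: finite_induct)
    case empty
    show ?case by (intro exI[of _ 0] exI[of _ "[:0, 1:]"]) (simp add: ser.ev_pCons pderiv_pCons)
  next
    case (insert x S)
    then obtain w f where w: "ser.ev w f = 0" "ser.ev w (pderiv f) \<noteq> 0" "S \<subseteq> rational_over w"
      by auto
    then have "ser.algebraic_over w"
      unfolding ser.algebraic_over_def by (intro exI[of _ f]) auto
    then obtain w' f' where "ser.ev w' f' = 0" "ser.ev w' (pderiv f') \<noteq> 0"
      "w \<in> rational_over w'" "x \<in> rational_over w'"
      using primitive_element[OF inf] insert.prems by blast
    then show ?case using w(3) rational_over_trans by blast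
  qed
  then show ?thesis using that by blast
qed

section \<open>Specialising algebraic power series over a large field\<close>

lemma eval_XY_0 [simp]: "eval_XY 0 a b = 0"
  by (simp add: eval_XY_def)

lemma eval_XY_1 [simp]: "eval_XY 1 a b = 1"
  by (simp add: eval_XY_def)

lemma eval_XY_pCons: "eval_XY (pCons c f) a b = poly c a + b * eval_XY f a b"
  by (simp add: eval_XY_def)

lemma eval_XY_add: "eval_XY (f + g) a b = eval_XY f a b + eval_XY g a b"
  by (simp add: eval_XY_def)

lemma eval_XY_diff: "eval_XY (f - g) a b = eval_XY f a b - eval_XY g a b"
  by (simp add: eval_XY_def)

lemma eval_XY_mult: "eval_XY (f * g) a b = eval_XY f a b * eval_XY g a b"
  by (simp add: eval_XY_def)

lemma eval_XY_smult: "eval_XY (smult c f) a b = poly c a * eval_XY f a b"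
  by (simp add: eval_XY_def)

lemma eval_XY_map_poly: "eval_XY f a b = poly (map_poly (\<lambda>q. poly q a) f) b"
  by (induction f) (simp_all add: eval_XY_pCons map_poly_pCons)

lemma eval_XY_origin: "eval_XY f 0 0 = coeff (coeff f 0) 0"
  by (cases f) (simp add: eval_XY_pCons poly_0_coeff_0)

lemma ev_nth_0: "ser.ev z f $ 0 = eval_XY f 0 (z $ 0)"
  by (induction f) (simp_all add: ser.ev_pCons eval_XY_pCons poly_0_coeff_0)

text \<open>The line \<open>Y = 0\<close> is smooth at the origin and has only finitely many points
  over a finite field.\<close>

lemma large_field_infinite:
  assumes "large_field TYPE('a::field)"
  shows "infinite (UNIV :: 'a set)"
proof
  assume "finite (UNIV :: 'a set)"
  then have "finite (UNIV :: ('a \<times> 'a) set)" by (simp add: finite_Prod_UNIV)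
  then have "finite {(a, b). eval_XY [:0, 1 :: 'a poly:] a b = 0}" by (rule finite_subset[rotated]) auto
  moreover have "eval_XY [:0, 1 :: 'a poly:] 0 0 = 0" "eval_XY (pderiv [:0, 1 :: 'a poly:]) 0 0 \<noteq> 0"
    by (simp_all add: eval_XY_pCons pderiv_pCons)
  ultimately show False using assms unfolding large_field_def by blast
qed

lemma ev_diff_dvd: "x - y dvd ser.ev x p - ser.ev y p"
proof (induction p)
  case 0
  then show ?case by simp
next
  case (pCons a p)
  have "ser.ev x (pCons a p) - ser.ev y (pCons a p) = x * (ser.ev x p - ser.ev y p) + (x - y) * ser.ev y p"
    by (simp add: ser.ev_pCons algebra_simps)
  then show ?case using pCons.IH by (simp add: dvd_add dvd_mult)
qed

lemma ev_fps_of_poly: "ser.ev (fps_of_poly s) p = fps_of_poly (poly p s)"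
  by (induction p) (simp_all add: ser.ev_pCons fps_of_poly_add fps_of_poly_mult)

lemma fps_X_power_dvd_nth: "fps_X ^ n dvd (x :: 'a::field fps) \<Longrightarrow> k < n \<Longrightarrow> x $ k = 0"
  by (auto simp: dvd_def fps_X_power_mult_nth)

lemma dvd_ev:
  assumes "\<And>k. r dvd coeff p k"
  shows "fps_of_poly r dvd ser.ev z p"
proof -
  have "[:r:] dvd p" using assms by (simp add: const_poly_dvd_iff)
  then obtain p' where "p = smult r p'" by (auto simp: dvd_def)
  then show ?thesis by (simp add: ser.ev_smult)
qed

text \<open>
  With \<open>e\<close> the order of \<open>f\<^sub>Y(t, w)\<close> and \<open>N = e + 1\<close>, write \<open>w = s + t\<^sup>N z\<close> with \<open>s\<close> a truncation of \<open>w\<close>;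
  then \<open>f(t, s + t\<^sup>N Z)\<close> is divisible by \<open>t\<close> to the power \<open>N + e\<close>, and the quotient is smooth at the origin.
\<close>

lemma smooth_model:
  fixes w :: "'a::field fps"
  assumes f: "ser.ev w f = 0" "ser.ev w (pderiv f) \<noteq> 0"
  obtains z g where "z $ 0 = 0" "ser.ev z g = 0" "eval_XY (pderiv g) 0 0 \<noteq> 0" "w \<in> rational_over z"
proof -
  define e where "e = subdegree (ser.ev w (pderiv f))"
  define N where "N = Suc e"
  \<comment> \<open>The truncation includes the coefficient of \<open>t ^ N\<close>, so that
    \<open>z\<close> has constant term 0.\<close>
  define s where "s = (\<Sum>i\<le>N. monom (w $ i) i)"
  have s: "coeff s i = (if i \<le> N then w $ i else 0)" for i
    by (simp add: s_def coeff_sum)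
  define z where "z = fps_shift N (w - fps_of_poly s)"
  have z0: "z $ 0 = 0" by (simp add: z_def s)
  have "fps_X ^ N * z = w - fps_of_poly s"
    by (intro fps_ext) (simp add: z_def s fps_X_power_mult_nth)
  then have wz: "w = fps_of_poly s + z * fps_X ^ N" by (simp add: algebra_simps)
  define L where "L = [:s, monom 1 N:]"
  have evL: "ser.ev z L = w"
    by (simp add: L_def ser.ev_pCons wz fps_of_poly_monom')
  define g1 where "g1 = pcompose f L"
  have g1: "ser.ev z g1 = 0" using f(1) by (simp add: g1_def evL flip: ser.ev_ev)
  \<comment> \<open>\<open>q\<close> is the Taylor expansion of \<open>f\<close> at
    \<open>s\<close>; the further substitution of \<open>t ^ N * Y\<close> multiplies its
    coefficient \<open>k\<close> by \<open>t ^ (N * k)\<close>.\<close>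
  define q where "q = pcompose f [:s, 1:]"
  have "pcompose [:s, 1:] [:0, monom 1 N:] = L"
    by (simp add: L_def pcompose_pCons)
  then have "g1 = pcompose q [:0, monom 1 N:]"
    by (simp add: g1_def q_def flip: pcompose_assoc)
  then have g1_coeff: "coeff g1 k = monom 1 (N * k) * coeff q k" for k
    by (simp add: coeff_pcompose_linear monom_power)
  have "pderiv q = pcompose (pderiv f) [:s, 1:]"
    by (simp add: q_def pderiv_pcompose pderiv_pCons)
  then have "coeff (pderiv q) 0 = poly (pderiv f) s"
    by (simp add: poly_pcompose flip: poly_0_coeff_0)
  then have q1: "coeff q 1 = poly (pderiv f) s" by (simp add: coeff_pderiv)
  \<comment> \<open>Since \<open>w\<close> and \<open>s\<close> agree modulo
    \<open>t ^ (N + 1)\<close> and \<open>e < N + 1\<close>, the linear coefficient of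
    \<open>q\<close> has the same order \<open>e\<close> as
    \<open>ser.ev w (pderiv f)\<close>.\<close>
  have "fps_X ^ Suc N dvd w - fps_of_poly s"
  proof -
    have "z = fps_X * fps_shift 1 z" using z0 by (intro fps_ext) auto
    then have "w - fps_of_poly s = fps_X ^ Suc N * fps_shift 1 z"
      by (subst wz) (simp add: mult_ac)
    then show ?thesis by (metis dvd_triv_left)
  qed
  then have "fps_X ^ Suc N dvd ser.ev w (pderiv f) - fps_of_poly (coeff q 1)"
    unfolding q1 ev_fps_of_poly[symmetric] using ev_diff_dvd dvd_trans by blast
  from fps_X_power_dvd_nth[OF this] have q1w: "coeff (coeff q 1) k = ser.ev w (pderiv f) $ k" if "k \<le> N" for k
    using that by simp
  have q1e: "coeff (coeff q 1) e \<noteq> 0"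
    using q1w[of e] f(2) by (simp add: N_def e_def)
  have q1_less: "coeff (coeff q 1) k = 0" if "k < e" for k
    using q1w[of k] nth_less_subdegree_zero[OF that[unfolded e_def]] that by (simp add: N_def)
  \<comment> \<open>\<open>M\<close> is the exact order of the linear coefficient of
    \<open>g1\<close>. For \<open>k \<ge> 2\<close> the order is at least
    \<open>2 * N = M + 1\<close>, which is the reason for \<open>N = e + 1\<close>.\<close>
  define M where "M = N + e"
  have c1: "coeff g1 1 = monom 1 N * coeff q 1" using g1_coeff[of 1] by simp
  have dvd1: "monom 1 M dvd coeff g1 1"
    unfolding c1 monom_1_dvd_iff' using q1_less by (auto simp: coeff_monom_mult M_def)
  have dvd2: "monom 1 (Suc M) dvd coeff g1 k" if "k \<ge> 2" for k
  proof -
    have "N * 2 \<le> N * k" using that by (intro mult_le_mono) auto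
    then have "monom 1 (Suc M) dvd (monom 1 (N * k) :: 'a poly)"
      unfolding monom_1_dvd_iff' by (auto simp: M_def N_def)
    then show ?thesis by (simp add: g1_coeff)
  qed
  \<comment> \<open>The constant coefficient is controlled by \<open>ser.ev z g1 = 0\<close>: all
    other terms carry a factor \<open>z\<close> of positive order and are divisible by
    \<open>t ^ (M + 1)\<close>.\<close>
  have dvd0: "monom 1 (Suc M) dvd coeff g1 0"
  proof -
    obtain a0 h1 where h1: "g1 = pCons a0 h1" by (cases g1)
    obtain a1 h2 where h2: "h1 = pCons a1 h2" by (cases h1)
    have a: "a0 = coeff g1 0" "a1 = coeff g1 1" and hk: "coeff h2 k = coeff g1 (Suc (Suc k))" for k
      by (simp_all add: h1 h2)
    have "fps_of_poly (monom 1 (Suc M)) dvd ser.ev z h2"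
      by (rule dvd_ev) (use dvd2 in \<open>simp add: hk\<close>)
    then have "fps_X ^ Suc M dvd z * (z * ser.ev z h2)"
      unfolding fps_of_poly_monom' by (intro dvd_mult)
    moreover have "fps_X ^ Suc M dvd z * fps_of_poly a1"
    proof -
      obtain u where "a1 = monom 1 M * u" using dvd1 a by auto
      moreover have "z = fps_X * fps_shift 1 z" using z0 by (intro fps_ext) auto
      ultimately have "z * fps_of_poly a1 = fps_X ^ Suc M * (fps_shift 1 z * fps_of_poly u)"
        by (simp add: fps_of_poly_mult fps_of_poly_monom' mult_ac)
      then show ?thesis by (metis dvd_triv_left)
    qed
    ultimately have "fps_X ^ Suc M dvd - (z * fps_of_poly a1 + z * (z * ser.ev z h2))"
      by (simp only: dvd_add dvd_minus_iff)
    moreover have "fps_of_poly a0 = - (z * fps_of_poly a1 + z * (z * ser.ev z h2))"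
      using g1 by (simp add: h1 h2 ser.ev_pCons algebra_simps eq_neg_iff_add_eq_0)
    ultimately have *: "fps_X ^ Suc M dvd fps_of_poly a0" by simp
    show ?thesis
      unfolding monom_1_dvd_iff' using fps_X_power_dvd_nth[OF *] a by simp
  qed
  have "monom 1 M dvd coeff g1 k" for k
  proof -
    have "monom 1 M dvd (monom 1 (Suc M) :: 'a poly)" unfolding monom_1_dvd_iff' by auto
    then show ?thesis
      using dvd0 dvd1 dvd2[of k] dvd_trans by (cases "k = 0"; cases "k = 1") auto
  qed
  then have "[:monom 1 M:] dvd g1" by (simp add: const_poly_dvd_iff)
  then obtain g where g: "g1 = smult (monom 1 M) g" by (auto simp: dvd_def)
  have gk: "coeff (coeff g k) 0 = coeff (coeff g1 k) M" for k
    by (simp add: g coeff_monom_mult)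
  have "ser.ev z g = 0"
    using g1 by (simp add: g ser.ev_smult fps_of_poly_monom')
  moreover have "coeff (coeff g 1) 0 \<noteq> 0"
    unfolding gk c1 using q1e by (simp add: coeff_monom_mult M_def)
  then have "eval_XY (pderiv g) 0 0 \<noteq> 0"
    by (simp add: eval_XY_origin coeff_pderiv)
  moreover have "w \<in> rational_over z"
    using rational_over_ev_self[of z L] by (simp add: evL)
  ultimately show ?thesis using that z0 by blast
qed

section \<open>Rational points of the curve as specialisations\<close>

lemma poly_coeffs_root_imp_smult:
  fixes a :: "'a::idom"
  assumes "map_poly (\<lambda>q. poly q a) S = 0"
  obtains S' where "S = smult [:- a, 1:] S'"
proof -
  have "poly (coeff S k) a = 0" for k
    using arg_cong[OF assms, of "\<lambda>p. coeff p k"] by (simp add: coeff_map_poly)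
  then have "[:[:- a, 1:]:] dvd S" by (simp add: const_poly_dvd_iff poly_eq_0_iff_dvd)
  then show ?thesis using that by (auto simp: dvd_def)
qed

text \<open>\<open>G\<close> has least degree in \<open>Y\<close>, so pseudo-division of a relation
  of \<open>z\<close> leaves no remainder; among these its leading coefficient has least degree, so
  no factor \<open>t - a\<close> divides it and its fibres are finite. Smoothness comes from
  \<open>g\<close>: in \<open>smult m g = G * S\<close> all factors \<open>t\<close> of
  \<open>m\<close> cancel, as \<open>G\<close> is nonzero modulo \<open>t\<close>.\<close>

lemma minimal_smooth_relation:
  fixes z :: "'a::field fps"
  assumes z0: "z $ 0 = 0" and g: "ser.ev z g = 0" "eval_XY (pderiv g) 0 0 \<noteq> 0"
  obtains G where "G \<noteq> 0" "ser.ev z G = 0" "eval_XY (pderiv G) 0 0 \<noteq> 0"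
    "\<And>a. map_poly (\<lambda>q. poly q a) G \<noteq> 0"
    "\<And>R. ser.ev z R = 0 \<Longrightarrow> \<exists>k S. smult (lead_coeff G ^ k) R = G * S"
proof -
  define I where "I = {R. R \<noteq> 0 \<and> ser.ev z R = 0}"
  have gI: "g \<in> I" using g by (auto simp: I_def)
  have wf: "wf (measures [degree, \<lambda>R :: 'a poly poly. degree (lead_coeff R)])" by simp
  obtain G where G: "G \<in> I"
    and min: "\<And>R. (R, G) \<in> measures [degree, \<lambda>R. degree (lead_coeff R)] \<Longrightarrow> R \<notin> I"
    using wfE_min[OF wf gI] by blast
  have G0: "G \<noteq> 0" "ser.ev z G = 0" using G by (auto simp: I_def)
  have prim: "map_poly (\<lambda>q. poly q a) G \<noteq> 0" for a
  proof
    assume "map_poly (\<lambda>q. poly q a) G = 0"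
    then obtain G' where G': "G = smult [:- a, 1:] G'" by (rule poly_coeffs_root_imp_smult)
    have "fps_of_poly [:- a, 1:] \<noteq> (0 :: 'a fps)" using ser.hom_eq_0D[of "[:- a, 1:]"] by auto
    with G0 G' have "G' \<in> I" by (auto simp: I_def ser.ev_smult)
    moreover have "lead_coeff G' \<noteq> 0" using G0 G' by auto
    then have "degree (lead_coeff G) = Suc (degree (lead_coeff G'))"
      unfolding G' lead_coeff_smult by (subst degree_mult_eq) auto
    then have "(G', G) \<in> measures [degree, \<lambda>R. degree (lead_coeff R)]"
      using G' by (simp add: degree_smult_eq)
    ultimately show False using min by blast
  qed
  have division: "\<exists>k S. smult (lead_coeff G ^ k) R = G * S" if R: "ser.ev z R = 0" for R
  proof -
    obtain S r where "pseudo_divmod R G = (S, r)" by fastforce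
    from pseudo_divmod[OF G0(1) this]
    have S: "smult (lead_coeff G ^ (Suc (degree R) - degree G)) R = G * S + r"
      and r: "r = 0 \<or> degree r < degree G" by auto
    have "r = smult (lead_coeff G ^ (Suc (degree R) - degree G)) R - G * S" using S by simp
    then have "ser.ev z r = 0" using R G0(2) by (simp add: ser.ev_diff ser.ev_smult ser.ev_mult)
    then have "r = 0" using r min[of r] by (auto simp: I_def)
    with S show ?thesis by auto
  qed
  have clear: "\<exists>m' S'. poly m' 0 \<noteq> 0 \<and> smult m' g = G * S'"
    if "m \<noteq> 0" "smult m g = G * S" for m S
    using that
  proof (induction "degree m" arbitrary: m S rule: less_induct)
    case less
    show ?case
    proof (cases "poly m 0 = 0")
      case False
      with less.prems show ?thesis by blast
    next
      case True
      then obtain m1 where m1: "m = [:0, 1:] * m1"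
        using poly_eq_0_iff_dvd[of m 0] by (auto simp: dvd_def)
      interpret P0: coeff_hom "\<lambda>q :: 'a poly. poly q 0" by unfold_locales auto
      interpret P: coeff_hom "map_poly (\<lambda>q :: 'a poly. poly q 0)" by (rule P0.map_poly_coeff_hom)
      have "map_poly (\<lambda>q. poly q 0) (smult m g) = 0"
        using True by (intro poly_eqI) (simp add: coeff_map_poly)
      then have "map_poly (\<lambda>q. poly q 0) G * map_poly (\<lambda>q. poly q 0) S = 0"
        using less.prems(2) by (simp flip: P.hom_mult)
      with prim have "map_poly (\<lambda>q. poly q 0) S = 0" by simp
      then obtain S1 where S1: "S = smult [:- 0, 1:] S1" by (rule poly_coeffs_root_imp_smult)
      have "smult [:0, 1:] (smult m1 g) = smult [:0, 1:] (G * S1)"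
        using less.prems(2) by (simp only: m1 S1 smult_smult mult_smult_right minus_zero)
      then have "smult m1 g = G * S1" by (metis smult_cancel pCons_eq_0_iff one_neq_zero)
      moreover have "m1 \<noteq> 0" "degree m1 < degree m"
        using less.prems(1) by (auto simp: m1 degree_mult_eq)
      ultimately show ?thesis using less.hyps by blast
    qed
  qed
  obtain k S where "smult (lead_coeff G ^ k) g = G * S" using division[OF g(1)] by blast
  with clear[of "lead_coeff G ^ k" S] G0(1) obtain m S'
    where m: "poly m 0 \<noteq> 0" "smult m g = G * S'" by auto
  \<comment> \<open>At the origin the summand with \<open>G\<close> vanishes because
    \<open>z $ 0 = 0\<close>, and the left side is nonzero; so \<open>pderiv G\<close> cannot vanish
    there.\<close>
  have "smult m (pderiv g) = G * pderiv S' + S' * pderiv G"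
    using arg_cong[OF m(2), of pderiv] by (simp add: pderiv_smult pderiv_mult)
  from arg_cong[OF this, of "\<lambda>f. eval_XY f 0 0"]
  have "poly m 0 * eval_XY (pderiv g) 0 0
      = eval_XY G 0 0 * eval_XY (pderiv S') 0 0 + eval_XY S' 0 0 * eval_XY (pderiv G) 0 0"
    by (simp add: eval_XY_smult eval_XY_add eval_XY_mult)
  moreover have "eval_XY G 0 0 = 0" using ev_nth_0[of z G] G0(2) z0 by simp
  ultimately have "eval_XY (pderiv G) 0 0 \<noteq> 0" using m(1) g(2) by auto
  then show ?thesis using that G0 prim division by blast
qed

text \<open>A K-algebra homomorphism to K on a subring of K[[t]]. The domain \<open>B\<close> is
  kept because a series whose denominator vanishes at the chosen point may have no value.\<close>

definition specialization :: "'a::field fps set \<Rightarrow> ('a fps \<Rightarrow> 'a) \<Rightarrow> bool" where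
  "specialization B \<phi> \<longleftrightarrow> (\<forall>a. fps_const a \<in> B \<and> \<phi> (fps_const a) = a) \<and>
     (\<forall>x\<in>B. \<forall>y\<in>B. x + y \<in> B \<and> \<phi> (x + y) = \<phi> x + \<phi> y \<and> x * y \<in> B \<and> \<phi> (x * y) = \<phi> x * \<phi> y)"

text \<open>Evaluation at \<open>t = a\<close>, \<open>z = b\<close>, extended to quotients. Two
  representations \<open>h / q\<close> and \<open>h' / q'\<close> of one series give the relation
  \<open>q * h' - q' * h\<close> of \<open>z\<close>, which vanishes at the point; so the value does
  not depend on the choice.\<close>

lemma specialization_at_point:
  fixes z :: "'a::field fps"
  assumes "\<And>R. ser.ev z R = 0 \<Longrightarrow> eval_XY R a b = 0"
  obtains B \<phi> where "specialization B \<phi>"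
    "\<And>q h \<alpha>. eval_XY q a b \<noteq> 0 \<Longrightarrow> ser.ev z q * \<alpha> = ser.ev z h \<Longrightarrow>
       \<alpha> \<in> B \<and> eval_XY q a b * \<phi> \<alpha> = eval_XY h a b"
proof -
  define D where "D \<alpha> q h \<longleftrightarrow> eval_XY q a b \<noteq> 0 \<and> ser.ev z q * \<alpha> = ser.ev z h" for \<alpha> q h
  define B where "B = {\<alpha>. \<exists>q h. D \<alpha> q h}"
  define \<phi> where "\<phi> \<alpha> = (SOME x. \<exists>q h. D \<alpha> q h \<and> eval_XY q a b * x = eval_XY h a b)" for \<alpha>
  have \<phi>: "eval_XY q a b * \<phi> \<alpha> = eval_XY h a b" if "D \<alpha> q h" for \<alpha> q h
  proof -
    have "\<exists>q h. D \<alpha> q h \<and> eval_XY q a b * \<phi> \<alpha> = eval_XY h a b"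
      unfolding \<phi>_def
      by (rule someI[of _ "eval_XY h a b / eval_XY q a b"])
         (intro exI[of _ q] exI[of _ h], use that in \<open>simp add: D_def\<close>)
    then obtain q' h' where *: "D \<alpha> q' h'" "eval_XY q' a b * \<phi> \<alpha> = eval_XY h' a b" by blast
    have "ser.ev z (q * h' - q' * h) = ser.ev z q * (ser.ev z q' * \<alpha>) - ser.ev z q' * (ser.ev z q * \<alpha>)"
      using that *(1) by (simp add: D_def ser.ev_diff ser.ev_mult)
    also have "\<dots> = 0" by (simp add: algebra_simps)
    finally have "eval_XY q a b * eval_XY h' a b = eval_XY q' a b * eval_XY h a b"
      using assms by (fastforce simp: eval_XY_diff eval_XY_mult)
    then have "eval_XY q' a b * (eval_XY q a b * \<phi> \<alpha>) = eval_XY q' a b * eval_XY h a b"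
      by (simp add: mult.left_commute[of "eval_XY q' a b"] *(2))
    then show ?thesis using *(1) by (simp add: D_def)
  qed
  have eqI: "\<phi> \<alpha> = x" if "D \<alpha> q h" "eval_XY q a b * x = eval_XY h a b" for \<alpha> q h x
    using \<phi>[OF that(1)] that by (metis D_def mult_left_cancel)
  have "specialization B \<phi>"
    unfolding specialization_def
  proof (intro conjI allI ballI)
    fix c
    have D: "D (fps_const c) 1 [:[:c:]:]" by (simp add: D_def fps_of_poly_const)
    then show "fps_const c \<in> B" by (auto simp: B_def)
    show "\<phi> (fps_const c) = c" by (rule eqI[OF D]) (simp add: eval_XY_pCons)
  next
    fix x y assume "x \<in> B" "y \<in> B"
    then obtain q h q' h' where D: "D x q h" "D y q' h'" by (auto simp: B_def)
    have "ser.ev z (q * q') * (x + y) = ser.ev z q' * (ser.ev z q * x) + ser.ev z q * (ser.ev z q' * y)"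
      by (simp add: ser.ev_mult algebra_simps)
    then have plus: "D (x + y) (q * q') (q' * h + q * h')"
      using D by (simp add: D_def eval_XY_mult ser.ev_mult ser.ev_add)
    have "ser.ev z (q * q') * (x * y) = (ser.ev z q * x) * (ser.ev z q' * y)"
      by (simp add: ser.ev_mult algebra_simps)
    also have "\<dots> = ser.ev z (h * h')" using D by (simp only: D_def ser.ev_mult)
    finally have times: "D (x * y) (q * q') (h * h')"
      using D unfolding D_def eval_XY_mult by simp
    from plus times show "x + y \<in> B" "x * y \<in> B" by (auto simp: B_def)
    show "\<phi> (x + y) = \<phi> x + \<phi> y"
      by (rule eqI[OF plus]) (simp add: eval_XY_mult eval_XY_add algebra_simps flip: \<phi>[OF D(1)] \<phi>[OF D(2)])
    show "\<phi> (x * y) = \<phi> x * \<phi> y"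
      by (rule eqI[OF times]) (simp add: eval_XY_mult algebra_simps flip: \<phi>[OF D(1)] \<phi>[OF D(2)])
  qed
  then show ?thesis
    using that \<phi> unfolding B_def D_def by blast
qed

text \<open>The algebraic element \<open>N(t, z)\<close> satisfies an equation whose constant
  coefficient \<open>p0(t)\<close> is nonzero. The equation persists at \<open>(a, b)\<close>, so
  \<open>N(a, b) = 0\<close> forces \<open>p0(a) = 0\<close>.\<close>

lemma finitely_many_bad_points:
  fixes z :: "'a::field fps"
  assumes "ser.algebraic_over z" "ser.ev z N \<noteq> 0"
  obtains F where "finite F"
    "\<And>a b. (\<And>R. ser.ev z R = 0 \<Longrightarrow> eval_XY R a b = 0) \<Longrightarrow> a \<notin> F \<Longrightarrow> eval_XY N a b \<noteq> 0"
proof -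
  obtain p where p: "coeff p 0 \<noteq> 0" "ser.ev (ser.ev z N) p = 0"
    using ser.algebraic_over_nonzero[OF ser.algebraic_over_ev[OF assms(1)] assms(2)] by blast
  obtain p0 p1 where p01: "p = pCons p0 p1" by (cases p)
  have 0: "ser.ev z ([:p0:] + N * pcompose p1 N) = 0"
    using p(2) by (simp add: p01 ser.ev_ev pcompose_pCons)
  show ?thesis
  proof (rule that[of "{a. poly p0 a = 0}"])
    show "finite {a. poly p0 a = 0}" using p(1) p01 by (intro poly_roots_finite) auto
    fix a b assume "\<And>R. ser.ev z R = 0 \<Longrightarrow> eval_XY R a b = 0" and a: "a \<notin> {a. poly p0 a = 0}"
    from this(1)[OF 0] have "poly p0 a + eval_XY N a b * eval_XY (pcompose p1 N) a b = 0"
      by (simp add: eval_XY_add eval_XY_mult eval_XY_pCons)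
    with a show "eval_XY N a b \<noteq> 0" by auto
  qed
qed

theorem large_field_specialization:
  fixes S :: "'a::field fps set"
  assumes large: "large_field TYPE('a)" and "finite S" "\<And>x. x \<in> S \<Longrightarrow> ser.algebraic_over x"
  obtains B \<phi> where "specialization B \<phi>" "S \<subseteq> B" "\<And>x. x \<in> S \<Longrightarrow> x \<noteq> 0 \<Longrightarrow> \<phi> x \<noteq> 0"
proof -
  obtain w f where w: "ser.ev w f = 0" "ser.ev w (pderiv f) \<noteq> 0" "S \<subseteq> rational_over w"
    using primitive_element_finite[OF large_field_infinite[OF large] assms(2,3)] by blast
  obtain z g where z: "z $ 0 = 0" "ser.ev z g = 0" "eval_XY (pderiv g) 0 0 \<noteq> 0" "w \<in> rational_over z"
    using smooth_model[OF w(1,2)] by blast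
  obtain G where G: "G \<noteq> 0" "ser.ev z G = 0" "eval_XY (pderiv G) 0 0 \<noteq> 0"
    "\<And>a. map_poly (\<lambda>q. poly q a) G \<noteq> 0"
    "\<And>R. ser.ev z R = 0 \<Longrightarrow> \<exists>k S. smult (lead_coeff G ^ k) R = G * S"
    using minimal_smooth_relation[OF z(1-3)] by blast
  have alg: "ser.algebraic_over z" using G(1,2) by (auto simp: ser.algebraic_over_def)
  have "eval_XY G 0 0 = 0" using ev_nth_0[of z G] G(2) z(1) by simp
  then have inf: "infinite {(a, b). eval_XY G a b = 0}"
    using large G(3) unfolding large_field_def by blast
  \<comment> \<open>Every fibre \<open>G(a, Y)\<close> is a nonzero polynomial, so infinitely many
    points have infinitely many first coordinates.\<close>
  have points: "\<exists>a b. a \<notin> F \<and> eval_XY G a b = 0" if "finite F" for F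
  proof (rule ccontr)
    assume "\<not> ?thesis"
    then have "{(a, b). eval_XY G a b = 0} \<subseteq> (SIGMA a:F. {b. poly (map_poly (\<lambda>q. poly q a) G) b = 0})"
      by (auto simp: eval_XY_map_poly)
    moreover have "finite (SIGMA a:F. {b. poly (map_poly (\<lambda>q. poly q a) G) b = 0})"
      using that G(4) by (intro finite_SigmaI poly_roots_finite)
    ultimately show False using inf finite_subset by blast
  qed
  have "\<forall>x\<in>S. \<exists>q h. ser.ev z q \<noteq> 0 \<and> ser.ev z q * x = ser.ev z h"
    using w(3) z(4) rational_over_trans unfolding rational_over_def by blast
  then obtain q h where qh: "\<And>x. x \<in> S \<Longrightarrow> ser.ev z (q x) \<noteq> 0"
    "\<And>x. x \<in> S \<Longrightarrow> ser.ev z (q x) * x = ser.ev z (h x)"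
    by metis
  have "\<exists>F. finite F \<and> (\<forall>a b. (\<forall>R. ser.ev z R = 0 \<longrightarrow> eval_XY R a b = 0) \<longrightarrow> a \<notin> F \<longrightarrow> eval_XY N a b \<noteq> 0)"
    if "ser.ev z N \<noteq> 0" for N
    using finitely_many_bad_points[OF alg that] by metis
  then obtain F where F: "\<And>N. ser.ev z N \<noteq> 0 \<Longrightarrow> finite (F N)"
    "\<And>N a b. ser.ev z N \<noteq> 0 \<Longrightarrow> (\<And>R. ser.ev z R = 0 \<Longrightarrow> eval_XY R a b = 0) \<Longrightarrow> a \<notin> F N
      \<Longrightarrow> eval_XY N a b \<noteq> 0"
    by metis
  \<comment> \<open>Outside \<open>E\<close> the leading coefficient of \<open>G\<close>, every
    denominator \<open>q x\<close>, and the numerator \<open>h x\<close> of every nonzero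
    \<open>x\<close> are nonzero.\<close>
  define E where "E = {a. poly (lead_coeff G) a = 0} \<union> (\<Union>x\<in>S. F (q x)) \<union> (\<Union>x\<in>S - {0}. F (h x))"
  have h: "ser.ev z (h x) \<noteq> 0" if "x \<in> S" "x \<noteq> 0" for x
    using qh(1)[OF that(1)] that(2) by (simp flip: qh(2)[OF that(1)])
  have "finite E"
    unfolding E_def using G(1) assms(2) qh(1) h F(1) by (auto intro!: poly_roots_finite)
  from points[OF this] obtain a b where ab: "a \<notin> E" "eval_XY G a b = 0" by blast
  \<comment> \<open>The factor introduced by pseudo-division is nonzero at \<open>a\<close>, so this
    point of \<open>G\<close> satisfies every relation of \<open>z\<close>.\<close>
  have ideal: "eval_XY R a b = 0" if "ser.ev z R = 0" for R
  proof -
    obtain k T where "smult (lead_coeff G ^ k) R = G * T" using G(5) \<open>ser.ev z R = 0\<close> by blast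
    from arg_cong[OF this, of "\<lambda>f. eval_XY f a b"]
    have "poly (lead_coeff G ^ k) a * eval_XY R a b = 0"
      using ab(2) by (simp add: eval_XY_smult eval_XY_mult)
    with ab(1) show ?thesis by (simp add: E_def)
  qed
  obtain B \<phi> where B: "specialization B \<phi>"
    "\<And>q h \<alpha>. eval_XY q a b \<noteq> 0 \<Longrightarrow> ser.ev z q * \<alpha> = ser.ev z h \<Longrightarrow>
       \<alpha> \<in> B \<and> eval_XY q a b * \<phi> \<alpha> = eval_XY h a b"
    using specialization_at_point[of z a b, OF ideal] by blast
  have q_ab: "eval_XY (q x) a b \<noteq> 0" if "x \<in> S" for x
    using F(2)[OF qh(1)[OF that] ideal] ab(1) that by (auto simp: E_def)
  have h_ab: "eval_XY (h x) a b \<noteq> 0" if "x \<in> S" "x \<noteq> 0" for x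
    using F(2)[OF h[OF that] ideal] ab(1) that by (auto simp: E_def)
  show ?thesis
  proof (rule that[OF B(1)])
    show "S \<subseteq> B" using B(2) q_ab qh(2) by blast
    show "\<phi> x \<noteq> 0" if "x \<in> S" "x \<noteq> 0" for x
      using B(2)[OF q_ab[OF that(1)] qh(2)[OF that(1)]] h_ab[OF that] by auto
  qed
qed

section \<open>Hensel's lemma for power series\<close>

lemma fps_X_power_dvd_iff: "fps_X ^ n dvd (x :: 'a::field fps) \<longleftrightarrow> (\<forall>k<n. x $ k = 0)"
proof
  assume "\<forall>k<n. x $ k = 0"
  then have "x = fps_X ^ n * fps_shift n x" by (intro fps_ext) (simp add: fps_X_power_mult_nth)
  then show "fps_X ^ n dvd x" by (metis dvd_triv_left)
qed (auto intro: fps_X_power_dvd_nth)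

lemma poly_taylor_2: "\<exists>u. poly P (x + d) = poly P x + poly (pderiv P) x * d + d\<^sup>2 * u" for x d :: "'a::idom"
proof (induction P)
  case 0
  show ?case by (intro exI[of _ 0]) simp
next
  case (pCons a P)
  then obtain u where u: "poly P (x + d) = poly P x + poly (pderiv P) x * d + d\<^sup>2 * u" by blast
  show ?case
    by (intro exI[of _ "x * u + poly (pderiv P) x + d * u"])
       (simp only: poly_pCons u pderiv_pCons poly_add, simp add: algebra_simps power2_eq_square)
qed

lemma poly_diff_dvd: "x - y dvd poly P x - poly P y" for x y :: "'a::idom"
proof -
  obtain u where u: "poly P (y + (x - y)) = poly P y + poly (pderiv P) y * (x - y) + (x - y)\<^sup>2 * u"
    using poly_taylor_2 by blast
  then have "poly P x - poly P y = (x - y) * (poly (pderiv P) y + (x - y) * u)"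
    by (simp add: algebra_simps power2_eq_square)
  then show ?thesis by simp
qed

lemma poly_fps_nth_0: "poly P x $ 0 = poly (map_poly (\<lambda>c. c $ 0) P) (x $ 0)"
  by (induction P) (simp_all add: map_poly_pCons)

text \<open>Newton iteration with the fixed slope \<open>d\<close> in place of the derivative: it
  gains one power of \<open>t\<close> per step.\<close>

lemma fps_hensel:
  fixes P :: "'a::field fps poly"
  assumes root: "poly (map_poly (\<lambda>c. c $ 0) P) r = 0"
    and simple: "poly (map_poly (\<lambda>c. c $ 0) (pderiv P)) r \<noteq> 0"
  obtains \<rho> where "\<rho> $ 0 = r" "poly P \<rho> = 0"
proof -
  define d where "d = poly (map_poly (\<lambda>c. c $ 0) (pderiv P)) r"
  have "\<exists>x. \<forall>n. (x n $ 0 = r \<and> fps_X ^ Suc n dvd poly P (x n)) \<and> fps_X ^ Suc n dvd x (Suc n) - x n"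
  proof (intro dependent_nat_choice)
    show "\<exists>x. x $ 0 = r \<and> fps_X ^ Suc 0 dvd poly P x"
      by (intro exI[of _ "fps_const r"]) (simp add: fps_X_power_dvd_iff[of 1, simplified] poly_fps_nth_0 root)
  next
    fix x n assume x: "x $ 0 = r \<and> fps_X ^ Suc n dvd poly P x"
    define v where "v = poly P x"
    define \<delta> where "\<delta> = - (fps_const (inverse d) * v)"
    have v: "fps_X ^ Suc n dvd v" using x by (simp add: v_def)
    then have \<delta>: "fps_X ^ Suc n dvd \<delta>" unfolding \<delta>_def by (subst dvd_minus_iff) (rule dvd_mult)
    obtain u where u: "poly P (x + \<delta>) = v + poly (pderiv P) x * \<delta> + \<delta>\<^sup>2 * u"
      unfolding v_def using poly_taylor_2 by blast
    \<comment> \<open>\<open>v * s\<close> is the linear part of the new error; \<open>s\<close> has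
      constant term 0 because the derivative at \<open>x\<close> reduces to
      \<open>d\<close>.\<close>
    define s where "s = 1 - poly (pderiv P) x * fps_const (inverse d)"
    have "s $ 0 = 0"
      using x simple by (simp add: s_def poly_fps_nth_0 d_def)
    then have "fps_X ^ 1 dvd s" unfolding fps_X_power_dvd_iff by auto
    from mult_dvd_mono[OF v this] have "fps_X ^ Suc (Suc n) dvd v * s" by (simp add: mult_ac)
    moreover have "v + poly (pderiv P) x * \<delta> = v * s" by (simp add: s_def \<delta>_def algebra_simps)
    moreover have "fps_X ^ Suc (Suc n) dvd \<delta>\<^sup>2 * u"
    proof -
      have "fps_X ^ Suc (Suc n) dvd fps_X ^ (Suc n + Suc n)" by (rule le_imp_power_dvd) simp
      also have "\<dots> dvd \<delta>\<^sup>2" using mult_dvd_mono[OF \<delta> \<delta>] by (simp only: power_add power2_eq_square)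
      finally show ?thesis by (rule dvd_mult2)
    qed
    ultimately have "fps_X ^ Suc (Suc n) dvd poly P (x + \<delta>)" unfolding u by simp
    moreover have "(x + \<delta>) $ 0 = r" using x fps_X_power_dvd_nth[OF \<delta>, of 0] by simp
    moreover have "fps_X ^ Suc n dvd (x + \<delta>) - x" using \<delta> by simp
    ultimately show "\<exists>y. (y $ 0 = r \<and> fps_X ^ Suc (Suc n) dvd poly P y) \<and> fps_X ^ Suc n dvd y - x"
      by blast
  qed
  then obtain x where x: "\<And>n. x n $ 0 = r" "\<And>n. fps_X ^ Suc n dvd poly P (x n)"
    "\<And>n. fps_X ^ Suc n dvd x (Suc n) - x n" by blast
  define \<rho> where "\<rho> = Abs_fps (\<lambda>n. x n $ n)"
  have stable: "x n $ k = x k $ k" if "k \<le> n" for n k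
    using that
  proof (induction n rule: dec_induct)
    case (step n)
    have "(x (Suc n) - x n) $ k = 0"
      using step.hyps by (intro fps_X_power_dvd_nth[OF x(3)]) simp
    then show ?case using step.IH by (metis fps_sub_nth eq_iff_diff_eq_0)
  qed simp
  have "poly P \<rho> $ n = 0" for n
  proof -
    have "fps_X ^ Suc n dvd \<rho> - x n"
      unfolding fps_X_power_dvd_iff
    proof (intro allI impI)
      fix k assume "k < Suc n"
      then have "x n $ k = x k $ k" by (intro stable) simp
      then show "(\<rho> - x n) $ k = 0" by (simp only: \<rho>_def fps_sub_nth fps_nth_Abs_fps diff_self)
    qed
    then have "fps_X ^ Suc n dvd poly P \<rho> - poly P (x n)" using poly_diff_dvd dvd_trans by blast
    from fps_X_power_dvd_nth[OF this, of n] fps_X_power_dvd_nth[OF x(2)[of n], of n]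
    show ?thesis by simp
  qed
  then have "poly P \<rho> = 0" by (intro fps_ext) simp
  moreover have "\<rho> $ 0 = r" by (simp add: \<rho>_def x(1))
  ultimately show ?thesis using that by blast
qed

section \<open>Approximating a neighbourhood basis by finite sets\<close>

definition hpoly :: "nat \<Rightarrow> (nat \<Rightarrow> 'b::idom) \<Rightarrow> 'b poly" where
  "hpoly n c = monom 1 n + monom 1 (n - 1) + (\<Sum>i\<le>n - 2. monom (c i) i)"

lemma hpoly_cong: "(\<And>i. i \<le> n - 2 \<Longrightarrow> c i = c' i) \<Longrightarrow> hpoly n c = hpoly n c'"
  by (simp add: hpoly_def)

lemma coeff_hpoly:
  "coeff (hpoly n c) k = (if k = n then 1 else 0) + (if k = n - 1 then 1 else 0) + (if k \<le> n - 2 then c k else 0)"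
  by (simp add: hpoly_def coeff_sum eq_commute[of k])

text \<open>
  The closure conditions that make \<open>Y\<close> a neighbourhood of \<open>0\<close> controlled by the smaller neighbourhood \<open>X\<close>.
  The element \<open>e\<close> records that the root is simple, so that it can be lifted to power series later on.
\<close>

definition hensel_step :: "(nat \<Rightarrow> 'b::idom) \<Rightarrow> nat \<Rightarrow> 'b set \<Rightarrow> 'b set \<Rightarrow> bool" where
  "hensel_step en k X Y \<longleftrightarrow> 0 \<in> X \<and> X \<subseteq> Y \<and> (\<forall>x\<in>X. \<forall>y\<in>X. x + y \<in> Y \<and> x * y \<in> Y) \<and>
     (\<forall>x\<in>X. - x \<in> Y) \<and> (\<forall>x\<in>X. \<forall>j\<le>k. en j * x \<in> Y) \<and>
     (\<forall>x\<in>X. \<exists>y\<in>Y. (1 + x) * (1 + y) = 1) \<and>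
     (\<forall>n\<in>{2..k + 2}. \<forall>c. (\<forall>i\<le>n - 2. c i \<in> X) \<longrightarrow>
        (\<exists>y\<in>Y. \<exists>e\<in>Y. poly (hpoly n c) (y - 1) = 0 \<and>
           (- 1) ^ (n - 1) * poly (pderiv (hpoly n c)) (y - 1) * (1 + e) = 1))"

lemma hensel_stepD:
  assumes "hensel_step en k X Y"
  shows "0 \<in> X" "X \<subseteq> Y" "x \<in> X \<Longrightarrow> y \<in> X \<Longrightarrow> x + y \<in> Y" "x \<in> X \<Longrightarrow> y \<in> X \<Longrightarrow> x * y \<in> Y"
    "x \<in> X \<Longrightarrow> - x \<in> Y" "x \<in> X \<Longrightarrow> j \<le> k \<Longrightarrow> en j * x \<in> Y"
    "x \<in> X \<Longrightarrow> \<exists>y\<in>Y. (1 + x) * (1 + y) = 1"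
    "2 \<le> n \<Longrightarrow> n \<le> k + 2 \<Longrightarrow> (\<And>i. i \<le> n - 2 \<Longrightarrow> c i \<in> X) \<Longrightarrow>
        \<exists>y\<in>Y. \<exists>e\<in>Y. poly (hpoly n c) (y - 1) = 0 \<and>
           (- 1) ^ (n - 1) * poly (pderiv (hpoly n c)) (y - 1) * (1 + e) = 1"
  using assms unfolding hensel_step_def by (blast, blast, blast, blast, blast, blast, blast, force)

text \<open>For zero coefficients the polynomial is \<open>X ^ (n - 1) * (X + 1)\<close>, with
  derivative \<open>(- 1) ^ (n - 1)\<close> at its root \<open>- 1\<close>. This is the origin of
  the sign in \<open>hensel_step\<close>, and \<open>y = e = 0\<close> are witnesses.\<close>

lemma hensel_step_trivial:
  assumes "0 \<in> Y"
  shows "hensel_step en k {0} Y"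
  unfolding hensel_step_def
proof (intro conjI ballI allI impI)
  fix n :: nat and c :: "nat \<Rightarrow> 'a"
  assume n: "n \<in> {2..k + 2}" and c: "\<forall>i\<le>n - 2. c i \<in> {0}"
  then obtain m where m: "n = Suc (Suc m)" by (metis atLeastAtMost_iff le_Suc_ex add_2_eq_Suc)
  have h: "hpoly n c = monom 1 (Suc (Suc m)) + monom 1 (Suc m)"
    using c by (simp add: hpoly_def m)
  have s: "(- 1) ^ m * (- 1) ^ m = (1 :: 'a)" by (simp flip: power_mult_distrib)
  show "\<exists>y\<in>Y. \<exists>e\<in>Y. poly (hpoly n c) (y - 1) = 0 \<and>
           (- 1) ^ (n - 1) * poly (pderiv (hpoly n c)) (y - 1) * (1 + e) = 1"
    unfolding h using assms s
    by (intro bexI[of _ 0]) (simp_all add: m poly_monom pderiv_add pderiv_monom algebra_simps)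
qed (use assms in auto)

text \<open>Reduction modulo \<open>t\<close> maps \<open>X\<close> into \<open>X0\<close>. Finitely
  many new elements are required, each with a constant term that \<open>step\<close> already
  provides in \<open>Y0\<close>; the Hensel roots are algebraic because they satisfy monic equations
  over algebraic elements.\<close>

lemma hensel_step_lift:
  fixes en :: "nat \<Rightarrow> 'a::field"
  assumes step: "hensel_step en k X0 Y0" and "finite Y0"
    and X: "finite X" "0 \<in> X" "\<And>x. x \<in> X \<Longrightarrow> ser.algebraic_over x" "\<And>x. x \<in> X \<Longrightarrow> x $ 0 \<in> X0"
  obtains Y where "finite Y" "\<And>y. y \<in> Y \<Longrightarrow> ser.algebraic_over y" "\<And>y. y \<in> Y \<Longrightarrow> y $ 0 \<in> Y0"
    "fps_const ` Y0 \<subseteq> Y" "hensel_step (\<lambda>j. fps_const (en j)) k X Y"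
proof -
  note D = hensel_stepD[OF step]
  define good where "good y \<longleftrightarrow> ser.algebraic_over y \<and> y $ 0 \<in> Y0" for y :: "'a fps"
  have const: "ser.algebraic_over (fps_const a)" for a :: 'a
    using ser.algebraic_over_hom[of "[:a:]"] by (simp add: fps_of_poly_const)
  have one: "ser.algebraic_over (1 :: 'a fps)" using const[of 1] by simp
  have "\<exists>y. good y \<and> (1 + x) * (1 + y) = 1" if "x \<in> X" for x
  proof -
    obtain y0 where y0: "y0 \<in> Y0" "(1 + x $ 0) * (1 + y0) = 1" using D(7) X(4) \<open>x \<in> X\<close> by blast
    then have "(1 + x) $ 0 \<noteq> 0" by auto
    then have inv: "(1 + x) * inverse (1 + x) = 1" by (rule inverse_mult_eq_1')
    define y where "y = inverse (1 + x) - 1"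
    have y: "(1 + x) * (1 + y) = 1" using inv by (simp add: y_def)
    have "(1 + x $ 0) * (1 + y $ 0) = 1" using arg_cong[OF y, of "\<lambda>f. f $ 0"] by simp
    with y0 have "y $ 0 = y0" by (metis add_left_cancel mult_cancel_left mult_zero_left zero_neq_one)
    moreover have "ser.algebraic_over (inverse (1 + x))"
      using ser.algebraic_over_inverse[OF _ inv] ser.algebraic_over_add[OF one X(3)[OF that]] by blast
    then have "ser.algebraic_over y" unfolding y_def using one by (rule ser.algebraic_over_diff)
    ultimately show ?thesis using y y0 by (auto simp: good_def)
  qed
  then obtain iv where iv: "\<And>x. x \<in> X \<Longrightarrow> good (iv x) \<and> (1 + x) * (1 + iv x) = 1" by metis
  define Q where "Q n c y e \<longleftrightarrow> poly (hpoly n c) (y - 1) = 0 \<and>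
     (- 1) ^ (n - 1) * poly (pderiv (hpoly n c)) (y - 1) * (1 + e) = 1" for n c and y e :: "'a fps"
  have "\<exists>y e. good y \<and> good e \<and> Q n c y e"
    if n: "2 \<le> n" "n \<le> k + 2" and c: "\<And>i. i \<le> n - 2 \<Longrightarrow> c i \<in> X" for n c
  proof -
    interpret Z: coeff_hom "\<lambda>x :: 'a fps. x $ 0" by unfold_locales auto
    define c0 where "c0 i = c i $ 0" for i
    have "\<exists>y\<in>Y0. \<exists>e\<in>Y0. poly (hpoly n c0) (y - 1) = 0 \<and>
           (- 1) ^ (n - 1) * poly (pderiv (hpoly n c0)) (y - 1) * (1 + e) = 1"
      by (rule D(8)[OF n]) (use c X(4) in \<open>auto simp: c0_def\<close>)
    then obtain y0 e0 where ye0: "y0 \<in> Y0" "e0 \<in> Y0" "poly (hpoly n c0) (y0 - 1) = 0"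
      "(- 1) ^ (n - 1) * poly (pderiv (hpoly n c0)) (y0 - 1) * (1 + e0) = 1" by blast
    have map: "map_poly (\<lambda>x. x $ 0) (hpoly n c) = hpoly n c0"
      by (intro poly_eqI) (simp add: coeff_map_poly coeff_hpoly c0_def)
    have map': "map_poly (\<lambda>x. x $ 0) (pderiv (hpoly n c)) = pderiv (hpoly n c0)"
      by (simp add: Z.map_poly_pderiv map)
    \<comment> \<open>The witness \<open>e0\<close> certifies that the root \<open>y0 - 1\<close> is
      simple.\<close>
    obtain \<rho> where \<rho>: "\<rho> $ 0 = y0 - 1" "poly (hpoly n c) \<rho> = 0"
      using fps_hensel[of "hpoly n c" "y0 - 1"] ye0 unfolding map map' by force
    obtain m where m: "n = Suc (Suc m)" using n(1) by (metis le_Suc_ex add_2_eq_Suc)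
    have coeffs: "ser.algebraic_over (coeff (hpoly n c) i)" for i
      using c X(3) by (auto simp: coeff_hpoly one m const[of 0, simplified])
    have "\<rho> ^ n + \<rho> ^ Suc m + (\<Sum>i\<le>m. c i * \<rho> ^ i) = 0"
      using \<rho>(2) by (simp add: hpoly_def m poly_monom poly_sum)
    then have "\<rho> ^ n = (\<Sum>i<n. (if i = Suc m then - 1 else - c i) * \<rho> ^ i)"
      by (simp add: m lessThan_Suc_atMost sum_negf eq_neg_iff_add_eq_0 algebra_simps)
    then have alg\<rho>: "ser.algebraic_over \<rho>"
      by (rule ser.algebraic_over_root[rotated])
         (use c X(3) one in \<open>auto simp: m intro!: ser.algebraic_over_uminus\<close>)
    have "ser.algebraic_over (poly (pderiv (hpoly n c)) \<rho>)"
      unfolding poly_altdef coeff_pderiv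
    proof (intro ser.algebraic_over_sum ser.algebraic_over_mult ser.algebraic_over_power alg\<rho> coeffs)
      show "ser.algebraic_over (of_nat i :: 'a fps)" for i
        using const[of "of_nat i"] by (simp add: fps_of_nat)
    qed
    moreover have "ser.algebraic_over ((- 1) ^ (n - 1) :: 'a fps)"
      by (intro ser.algebraic_over_power ser.algebraic_over_uminus one)
    ultimately have alg: "ser.algebraic_over ((- 1) ^ (n - 1) * poly (pderiv (hpoly n c)) \<rho>)"
      (is "ser.algebraic_over ?d") by (intro ser.algebraic_over_mult)
    have d0: "?d $ 0 = (- 1) ^ (n - 1) * poly (pderiv (hpoly n c0)) (y0 - 1)"
      by (simp add: poly_fps_nth_0 map' \<rho>(1) fps_power_zeroth)
    then have "?d $ 0 \<noteq> 0" using ye0(4) by auto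
    then have inv: "?d * inverse ?d = 1" by (rule inverse_mult_eq_1')
    define e where "e = inverse ?d - 1"
    have e: "?d * (1 + e) = 1" using inv by (simp add: e_def)
    have "?d $ 0 * (1 + e $ 0) = 1" using arg_cong[OF e, of "\<lambda>f. f $ 0"] by simp
    with ye0(4) have "e $ 0 = e0"
      unfolding d0 by (metis add_left_cancel mult_cancel_left mult_zero_left zero_neq_one)
    moreover have "ser.algebraic_over e"
      unfolding e_def using ser.algebraic_over_inverse[OF alg inv] one by (rule ser.algebraic_over_diff)
    moreover have "ser.algebraic_over (\<rho> + 1)" using alg\<rho> one by (rule ser.algebraic_over_add)
    ultimately have "good (\<rho> + 1)" "good e" using ye0 \<rho>(1) by (auto simp: good_def)
    moreover have "Q n c (\<rho> + 1) e" using \<rho>(2) e by (simp add: Q_def)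
    ultimately show ?thesis by blast
  qed
  then obtain yf ef where ye: "\<And>n c. 2 \<le> n \<Longrightarrow> n \<le> k + 2 \<Longrightarrow> (\<And>i. i \<le> n - 2 \<Longrightarrow> c i \<in> X) \<Longrightarrow>
      good (yf n c) \<and> good (ef n c) \<and> Q n c (yf n c) (ef n c)" by metis
  \<comment> \<open>Extensional coefficient tuples, so that there are finitely many;
    \<open>hpoly n c\<close> depends only on the values \<open>c i\<close> with
    \<open>i \<le> n - 2\<close>.\<close>
  define T where "T = (SIGMA n:{2..k + 2}. {..n - 2} \<rightarrow>\<^sub>E X)"
  have "finite T" unfolding T_def using X(1) by (intro finite_SigmaI finite_PiE) auto
  define Y where "Y = fps_const ` Y0 \<union> X \<union> (\<Union>x\<in>X. \<Union>y\<in>X. {x + y, x * y}) \<union> (\<Union>x\<in>X. {- x, iv x}) \<union>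
    (\<Union>j\<le>k. \<Union>x\<in>X. {fps_const (en j) * x}) \<union> (\<Union>t\<in>T. {yf (fst t) (snd t), ef (fst t) (snd t)})"
  have "finite Y" unfolding Y_def using X(1) \<open>finite Y0\<close> \<open>finite T\<close> by auto
  have T: "good (yf n c) \<and> good (ef n c) \<and> Q n c (yf n c) (ef n c)" if "(n, c) \<in> T" for n c
    using that unfolding T_def by (intro ye) (auto simp: PiE_iff)
  have good_X: "good x" "good (- x)" "good (iv x)" if "x \<in> X" for x
    using that D(2,5) X iv by (auto simp: good_def intro: ser.algebraic_over_uminus)
  have good_XX: "good (x + y)" "good (x * y)" if "x \<in> X" "y \<in> X" for x y
    using that D(3,4) X by (auto simp: good_def intro: ser.algebraic_over_add ser.algebraic_over_mult)
  have good_en: "good (fps_const (en j) * x)" if "x \<in> X" "j \<le> k" for j x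
    using that D(6) X const by (auto simp: good_def intro: ser.algebraic_over_mult)
  have good_const: "good (fps_const a)" if "a \<in> Y0" for a
    using that const by (simp add: good_def)
  have good: "good y" if "y \<in> Y" for y
    using that T good_X good_XX good_en good_const unfolding Y_def by auto
  have YI: "X \<subseteq> Y" "\<And>x y. x \<in> X \<Longrightarrow> y \<in> X \<Longrightarrow> x + y \<in> Y" "\<And>x y. x \<in> X \<Longrightarrow> y \<in> X \<Longrightarrow> x * y \<in> Y"
    "\<And>x. x \<in> X \<Longrightarrow> - x \<in> Y" "\<And>x. x \<in> X \<Longrightarrow> iv x \<in> Y"
    "\<And>j x. j \<le> k \<Longrightarrow> x \<in> X \<Longrightarrow> fps_const (en j) * x \<in> Y" "fps_const ` Y0 \<subseteq> Y"
    unfolding Y_def by blast+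
  have YT: "yf n c \<in> Y" "ef n c \<in> Y" if "(n, c) \<in> T" for n c
    using that unfolding Y_def by force+
  have "hensel_step (\<lambda>j. fps_const (en j)) k X Y"
    unfolding hensel_step_def
  proof (intro conjI ballI allI impI)
    fix n c assume n: "n \<in> {2..k + 2}" and c: "\<forall>i\<le>n - 2. c i \<in> X"
    define c' where "c' = restrict c {..n - 2}"
    have t: "(n, c') \<in> T" using n c by (auto simp: T_def c'_def)
    have "hpoly n c' = hpoly n c" by (rule hpoly_cong) (simp add: c'_def)
    with YT[OF t] T[OF t] show "\<exists>y\<in>Y. \<exists>e\<in>Y. poly (hpoly n c) (y - 1) = 0 \<and>
           (- 1) ^ (n - 1) * poly (pderiv (hpoly n c)) (y - 1) * (1 + e) = 1"
      unfolding Q_def by auto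
  next
    fix x assume "x \<in> X"
    then show "\<exists>y\<in>Y. (1 + x) * (1 + y) = 1" using iv YI(5) by blast
  qed (use X(2) YI in blast)+
  then show ?thesis using that \<open>finite Y\<close> good YI(7) unfolding good_def by blast
qed

section \<open>Transport of the closure conditions along a specialisation\<close>

context
  fixes B :: "'a::field fps set" and \<phi> :: "'a fps \<Rightarrow> 'a"
  assumes spec: "specialization B \<phi>"
begin

lemma specialization_simps:
  "fps_const a \<in> B" "\<phi> (fps_const a) = a"
  "0 \<in> B" "\<phi> 0 = 0" "1 \<in> B" "\<phi> 1 = 1"
  "x \<in> B \<Longrightarrow> y \<in> B \<Longrightarrow> x + y \<in> B" "x \<in> B \<Longrightarrow> y \<in> B \<Longrightarrow> \<phi> (x + y) = \<phi> x + \<phi> y"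
  "x \<in> B \<Longrightarrow> y \<in> B \<Longrightarrow> x * y \<in> B" "x \<in> B \<Longrightarrow> y \<in> B \<Longrightarrow> \<phi> (x * y) = \<phi> x * \<phi> y"
proof -
  show c: "fps_const a \<in> B" "\<phi> (fps_const a) = a" for a
    using spec by (auto simp: specialization_def)
  show "0 \<in> B" "\<phi> 0 = 0" "1 \<in> B" "\<phi> 1 = 1" using c[of 0] c[of 1] by simp_all
qed (use spec in \<open>auto simp: specialization_def\<close>)

lemma specialization_uminus: "x \<in> B \<Longrightarrow> - x \<in> B" "x \<in> B \<Longrightarrow> \<phi> (- x) = - \<phi> x"
  using specialization_simps(9)[of "fps_const (- 1)" x] specialization_simps(10)[of "fps_const (- 1)" x]
    specialization_simps(1)[of "- 1"] specialization_simps(2)[of "- 1"]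
  by (simp_all flip: fps_const_neg)

lemma specialization_diff: "x \<in> B \<Longrightarrow> y \<in> B \<Longrightarrow> x - y \<in> B"
    "x \<in> B \<Longrightarrow> y \<in> B \<Longrightarrow> \<phi> (x - y) = \<phi> x - \<phi> y"
  using specialization_simps(7)[of x "- y"] specialization_simps(8)[of x "- y"] specialization_uminus
  by simp_all

lemma specialization_of_nat: "of_nat n \<in> B" "\<phi> (of_nat n) = of_nat n"
  using specialization_simps(1,2)[of "of_nat n"] by (simp_all add: fps_of_nat)

lemma specialization_power: "x \<in> B \<Longrightarrow> x ^ n \<in> B \<and> \<phi> (x ^ n) = \<phi> x ^ n"
  by (induction n) (auto simp: specialization_simps)

lemma specialization_poly:
  assumes "\<And>i. coeff P i \<in> B" "x \<in> B"
  shows "poly P x \<in> B \<and> \<phi> (poly P x) = poly (map_poly \<phi> P) (\<phi> x)"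
  using assms
proof (induction P)
  case 0
  then show ?case by (simp add: specialization_simps)
next
  case (pCons a P)
  have "a \<in> B" "\<And>i. coeff P i \<in> B"
    using pCons.prems(1)[of 0] pCons.prems(1)[of "Suc _"] by simp_all
  with pCons.IH pCons.prems(2) show ?case
    by (simp add: map_poly_pCons specialization_simps)
qed

lemma specialization_hpoly:
  assumes n: "2 \<le> n" and c: "\<And>i. i \<le> n - 2 \<Longrightarrow> c i \<in> B" and x: "x \<in> B"
  shows "\<phi> (poly (hpoly n c) x) = poly (hpoly n (\<lambda>i. \<phi> (c i))) (\<phi> x)"
    and "poly (pderiv (hpoly n c)) x \<in> B"
    and "\<phi> (poly (pderiv (hpoly n c)) x) = poly (pderiv (hpoly n (\<lambda>i. \<phi> (c i)))) (\<phi> x)"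
proof -
  have B: "coeff (hpoly n c) i \<in> B" for i
    using n c by (auto simp: coeff_hpoly specialization_simps)
  have B': "coeff (pderiv (hpoly n c)) i \<in> B" for i
    using specialization_simps(9)[OF specialization_of_nat(1)[of "Suc i"] B[of "Suc i"]]
    by (simp add: coeff_pderiv)
  have map: "map_poly \<phi> (hpoly n c) = hpoly n (\<lambda>i. \<phi> (c i))"
    using n by (intro poly_eqI) (auto simp: coeff_map_poly coeff_hpoly specialization_simps)
  have "map_poly \<phi> (pderiv (hpoly n c)) = pderiv (map_poly \<phi> (hpoly n c))"
  proof (rule poly_eqI)
    fix i
    show "coeff (map_poly \<phi> (pderiv (hpoly n c))) i = coeff (pderiv (map_poly \<phi> (hpoly n c))) i"
      using specialization_simps(10)[OF specialization_of_nat(1)[of "Suc i"] B[of "Suc i"]]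
      by (simp add: coeff_map_poly specialization_simps(4) coeff_pderiv specialization_of_nat
          del: of_nat_Suc)
  qed
  with map have map': "map_poly \<phi> (pderiv (hpoly n c)) = pderiv (hpoly n (\<lambda>i. \<phi> (c i)))" by simp
  show "\<phi> (poly (hpoly n c) x) = poly (hpoly n (\<lambda>i. \<phi> (c i))) (\<phi> x)"
    using specialization_poly[OF B x] map by simp
  show "poly (pderiv (hpoly n c)) x \<in> B"
    "\<phi> (poly (pderiv (hpoly n c)) x) = poly (pderiv (hpoly n (\<lambda>i. \<phi> (c i)))) (\<phi> x)"
    using specialization_poly[OF B' x] map' by simp_all
qed

text \<open>Every condition is an equation with witnesses in \<open>Y\<close>, hence preserved by a
  ring homomorphism. This is why simplicity of the root is expressed through the inverse
  \<open>1 + e\<close>: mere nonvanishing of the derivative need not survive.\<close>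

lemma hensel_step_specialize:
  assumes step: "hensel_step (\<lambda>j. fps_const (en j)) k X Y" and Y: "Y \<subseteq> B"
  shows "hensel_step en k (\<phi> ` X) (\<phi> ` Y)"
  unfolding hensel_step_def
proof (intro conjI ballI allI impI)
  note D = hensel_stepD[OF step]
  have X: "x \<in> B" if "x \<in> X" for x using that D(2) Y by auto
  note S = specialization_simps specialization_uminus
  show "0 \<in> \<phi> ` X" using D(1) S(4) by force
  show "\<phi> ` X \<subseteq> \<phi> ` Y" using D(2) by auto
  fix x assume "x \<in> \<phi> ` X"
  then obtain x' where x': "x' \<in> X" "x = \<phi> x'" by auto
  show "- x \<in> \<phi> ` Y" using D(5)[OF x'(1)] S(12)[OF X[OF x'(1)]] x'(2) by force
  show "en j * x \<in> \<phi> ` Y" if "j \<le> k" for j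
    using D(6)[OF x'(1) that] S(10)[OF S(1) X[OF x'(1)], of "en j"] x'(2) S(2) by force
  obtain y' where y': "y' \<in> Y" "(1 + x') * (1 + y') = 1" using D(7)[OF x'(1)] by blast
  have "\<phi> ((1 + x') * (1 + y')) = (1 + \<phi> x') * (1 + \<phi> y')"
    using X[OF x'(1)] y'(1) Y by (simp add: S subset_iff)
  then show "\<exists>y\<in>\<phi> ` Y. (1 + x) * (1 + y) = 1" using y' x'(2) S(6) by auto
  fix y assume "y \<in> \<phi> ` X"
  then obtain y' where y': "y' \<in> X" "y = \<phi> y'" by auto
  show "x + y \<in> \<phi> ` Y" "x * y \<in> \<phi> ` Y"
    using D(3)[OF x'(1) y'(1)] D(4)[OF x'(1) y'(1)] S(8,10)[OF X[OF x'(1)] X[OF y'(1)]] x'(2) y'(2)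
    by force+
next
  note D = hensel_stepD[OF step]
  have X: "x \<in> B" if "x \<in> X" for x using that D(2) Y by auto
  fix n c assume n: "n \<in> {2..k + 2}" and c: "\<forall>i\<le>n - 2. c i \<in> \<phi> ` X"
  then have "\<forall>i. \<exists>x. i \<le> n - 2 \<longrightarrow> x \<in> X \<and> c i = \<phi> x" by blast
  then obtain c' where c': "\<And>i. i \<le> n - 2 \<Longrightarrow> c' i \<in> X" "\<And>i. i \<le> n - 2 \<Longrightarrow> c i = \<phi> (c' i)" by metis
  have h: "hpoly n c = hpoly n (\<lambda>i. \<phi> (c' i))" by (rule hpoly_cong) (rule c'(2))
  have n2: "2 \<le> n" "n \<le> k + 2" using n by auto
  obtain y e where ye: "y \<in> Y" "e \<in> Y" "poly (hpoly n c') (y - 1) = 0"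
    "(- 1) ^ (n - 1) * poly (pderiv (hpoly n c')) (y - 1) * (1 + e) = 1"
    using D(8)[OF n2, of c'] c'(1) by blast
  have B: "y \<in> B" "e \<in> B" "y - 1 \<in> B" using ye Y specialization_simps(5) specialization_diff(1) by auto
  have \<phi>y: "\<phi> (y - 1) = \<phi> y - 1" using specialization_diff(2) specialization_simps(5,6) B by simp
  have H: "\<phi> (poly (hpoly n c') (y - 1)) = poly (hpoly n (\<lambda>i. \<phi> (c' i))) (\<phi> (y - 1))"
    "poly (pderiv (hpoly n c')) (y - 1) \<in> B"
    "\<phi> (poly (pderiv (hpoly n c')) (y - 1)) = poly (pderiv (hpoly n (\<lambda>i. \<phi> (c' i)))) (\<phi> (y - 1))"
    by (rule specialization_hpoly; use n2 c'(1) X B(3) in blast)+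
  have pw: "(- 1) ^ (n - 1) \<in> B" "\<phi> ((- 1) ^ (n - 1)) = (- 1) ^ (n - 1)"
    using specialization_power[of "- 1" "n - 1"] specialization_uminus[of 1] specialization_simps(5,6)
    by simp_all
  have "poly (hpoly n c) (\<phi> y - 1) = 0"
    using H(1) ye(3) specialization_simps(4) by (simp add: h \<phi>y)
  moreover have "\<phi> ((- 1) ^ (n - 1) * poly (pderiv (hpoly n c')) (y - 1) * (1 + e)) =
      (- 1) ^ (n - 1) * poly (pderiv (hpoly n c)) (\<phi> y - 1) * (1 + \<phi> e)"
    using pw H(2,3) B by (simp add: specialization_simps h \<phi>y)
  ultimately show "\<exists>y\<in>\<phi> ` Y. \<exists>e\<in>\<phi> ` Y. poly (hpoly n c) (y - 1) = 0 \<and>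
      (- 1) ^ (n - 1) * poly (pderiv (hpoly n c)) (y - 1) * (1 + e) = 1"
    using ye specialization_simps(6) by auto
qed

end

text \<open>Since the levels beyond some \<open>M\<close> are \<open>{0}\<close>, an extension can
  start at level \<open>M\<close>, where only the formal variable is new.\<close>

definition finite_approximation :: "(nat \<Rightarrow> 'a::field) \<Rightarrow> (nat \<Rightarrow> 'a set) \<Rightarrow> bool" where
  "finite_approximation en V \<longleftrightarrow> (\<forall>k. finite (V k)) \<and> (\<forall>k. hensel_step en k (V (Suc k)) (V k)) \<and>
     1 \<notin> V 0 \<and> (\<exists>M. \<forall>k>M. V k = {0})"

lemma hensel_step_antimono:
  assumes "\<And>k. hensel_step en k (V (Suc k)) (V k)" "k \<le> l"
  shows "V l \<subseteq> V k"
  using assms(2) by (induction l rule: dec_induct) (use hensel_stepD(2)[OF assms(1)] in auto)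

text \<open>
  A new element is adjoined at level \<open>m\<close> by running the closure process with a formal variable in its
  place, and then specialising the resulting finite set of algebraic power series. Setting the variable
  to \<open>0\<close> gives back the old approximation, so no formal element equals \<open>1\<close> at level \<open>0\<close>.
\<close>

lemma finite_approximation_extend:
  fixes en :: "nat \<Rightarrow> 'a::field"
  assumes large: "large_field TYPE('a)" and V: "finite_approximation en V"
  obtains V' x where "finite_approximation en V'" "\<And>k. V k \<subseteq> V' k" "x \<in> V' m" "x \<noteq> 0"
proof -
  have fin: "finite (V k)" and step: "hensel_step en k (V (Suc k)) (V k)" and one: "1 \<notin> V 0" for k
    using V by (auto simp: finite_approximation_def)
  have zero: "0 \<in> V k" for k using hensel_stepD(1,2)[OF step[of k]] by auto
  obtain M0 where M0: "\<And>k. k > M0 \<Longrightarrow> V k = {0}" using V by (auto simp: finite_approximation_def)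
  define M where "M = max m M0"
  have M: "V k = {0}" if "k > M" for k using that M0 by (simp add: M_def)
  let ?en = "\<lambda>j. fps_const (en j)"
  \<comment> \<open>\<open>G n\<close> will live at level \<open>M - n\<close>: the closure runs
    from level \<open>M\<close> down to level 0.\<close>
  define good where "good n X \<longleftrightarrow> finite X \<and> (\<forall>x\<in>X. ser.algebraic_over x \<and> x $ 0 \<in> V (M - n)) \<and>
      fps_const ` V (M - n) \<subseteq> X" for n X
  have "\<exists>G. \<forall>n. ((n \<le> M \<longrightarrow> good n (G n)) \<and> (n = 0 \<longrightarrow> fps_X \<in> G n)) \<and>
      (n < M \<longrightarrow> hensel_step ?en (M - Suc n) (G n) (G (Suc n)))"
  proof (intro dependent_nat_choice)
    have "ser.algebraic_over (fps_X :: 'a fps)" "ser.algebraic_over (fps_const a)" for a :: 'a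
      using ser.algebraic_over_hom[of "[:0, 1:]"] ser.algebraic_over_hom[of "[:a:]"]
      by (simp_all add: fps_of_poly_const)
    then show "\<exists>X. (0 \<le> M \<longrightarrow> good 0 X) \<and> (0 = (0::nat) \<longrightarrow> fps_X \<in> X)"
      using fin zero by (intro exI[of _ "insert fps_X (fps_const ` V M)"]) (auto simp: good_def)
  next
    fix X n assume X: "(n \<le> M \<longrightarrow> good n X) \<and> (n = 0 \<longrightarrow> fps_X \<in> X)"
    show "\<exists>Y. ((Suc n \<le> M \<longrightarrow> good (Suc n) Y) \<and> (Suc n = 0 \<longrightarrow> fps_X \<in> Y)) \<and>
        (n < M \<longrightarrow> hensel_step ?en (M - Suc n) X Y)"
    proof (cases "n < M")
      case True
      then have eq: "M - n = Suc (M - Suc n)" by simp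
      have g: "good n X" using X True by simp
      have "0 \<in> X" using g zero[of "M - n"] by (force simp: good_def)
      then obtain Y where "finite Y" "\<And>y. y \<in> Y \<Longrightarrow> ser.algebraic_over y"
        "\<And>y. y \<in> Y \<Longrightarrow> y $ 0 \<in> V (M - Suc n)" "fps_const ` V (M - Suc n) \<subseteq> Y"
        "hensel_step ?en (M - Suc n) X Y"
        using g hensel_step_lift[OF step[of "M - Suc n"] fin, of X] unfolding good_def eq by blast
      then show ?thesis by (auto simp: good_def)
    qed auto
  qed
  then obtain G where G: "\<And>n. n \<le> M \<Longrightarrow> good n (G n)" "fps_X \<in> G 0"
    "\<And>n. n < M \<Longrightarrow> hensel_step ?en (M - Suc n) (G n) (G (Suc n))" by blast
  \<comment> \<open>The elements \<open>x - 1\<close> are included so that no series other than 1 at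
    level 0 specialises to 1.\<close>
  define S where "S = (\<Union>n\<le>M. G n) \<union> (\<lambda>x. x - 1) ` G M"
  have algone: "ser.algebraic_over (1 :: 'a fps)" using ser.algebraic_over_hom[of 1] by simp
  have "finite S" using G(1) by (auto simp: S_def good_def)
  moreover have "ser.algebraic_over x" if "x \<in> S" for x
    using that G(1) ser.algebraic_over_diff[OF _ algone] by (auto simp: S_def good_def)
  ultimately obtain B \<phi> where B: "specialization B \<phi>" "S \<subseteq> B" "\<And>x. x \<in> S \<Longrightarrow> x \<noteq> 0 \<Longrightarrow> \<phi> x \<noteq> 0"
    using large_field_specialization[OF large] by metis
  define V' where "V' k = (if k \<le> M then \<phi> ` G (M - k) else {0})" for k
  have sub: "V k \<subseteq> V' k" for k
  proof (cases "k \<le> M")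
    case True
    then have "fps_const ` V k \<subseteq> G (M - k)" using G(1)[of "M - k"] by (simp add: good_def)
    then have "\<phi> (fps_const a) \<in> V' k" if "a \<in> V k" for a
      using that True by (auto simp: V'_def)
    then show ?thesis by (auto simp: specialization_simps(2)[OF B(1)])
  next
    case False
    then show ?thesis using M by (simp add: V'_def)
  qed
  have "finite (V' k)" for k using G(1)[of "M - k"] by (simp add: V'_def good_def)
  moreover have step': "hensel_step en k (V' (Suc k)) (V' k)" for k
  proof (cases "k < M")
    case True
    then have eq: "M - k = Suc (M - Suc k)" "M - Suc (M - Suc k) = k" "M - Suc k < M" by auto
    have "hensel_step ?en k (G (M - Suc k)) (G (M - k))" using G(3)[OF eq(3)] by (simp only: eq)
    moreover have "G (M - k) \<subseteq> (\<Union>n\<le>M. G n)" by (rule UN_upper) simp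
    then have "G (M - k) \<subseteq> B" using B(2) unfolding S_def by blast
    ultimately show ?thesis
      using True hensel_step_specialize[OF B(1)] by (simp add: V'_def)
  next
    case False
    then have "V' (Suc k) = {0}" by (simp add: V'_def)
    moreover have "0 \<in> V' k" using sub zero by blast
    ultimately show ?thesis by (simp add: hensel_step_trivial)
  qed
  moreover have "1 \<notin> V' 0"
  proof
    assume "1 \<in> V' 0"
    then obtain x where x: "x \<in> G M" "\<phi> x = 1" by (auto simp: V'_def)
    have "x $ 0 \<in> V 0" using G(1)[of M] x by (auto simp: good_def)
    with one have "x - 1 \<noteq> 0" by auto
    moreover have "x - 1 \<in> S" "x \<in> S" using x by (auto simp: S_def)
    ultimately have "\<phi> (x - 1) \<noteq> 0" using B(3) by blast
    moreover have "\<phi> (x - 1) = \<phi> x - \<phi> 1"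
      using \<open>x \<in> S\<close> B(2) specialization_diff(2)[OF B(1)] specialization_simps(5)[OF B(1)] by blast
    ultimately show False using x(2) specialization_simps(6)[OF B(1)] by simp
  qed
  moreover have "\<forall>k>M. V' k = {0}" by (simp add: V'_def)
  ultimately have "finite_approximation en V'" unfolding finite_approximation_def by blast
  moreover have "fps_X \<in> S" using G(2) by (auto simp: S_def)
  then have "\<phi> fps_X \<noteq> 0" using B(3) by auto
  moreover have "\<phi> fps_X \<in> V' M" using G(2) by (simp add: V'_def)
  then have "\<phi> fps_X \<in> V' m"
    using hensel_step_antimono[of en V' m M] step' by (auto simp: M_def)
  ultimately show ?thesis using that sub by blast
qed

text \<open>Stage \<open>i\<close> puts a nonzero element into level \<open>i\<close>. Each closure
  condition involves finitely many elements, all present at one stage, and so passes to the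
  union.\<close>

lemma hensel_filtration_exists:
  fixes en :: "nat \<Rightarrow> 'a::field"
  assumes large: "large_field TYPE('a)"
  obtains U where "\<And>k. hensel_step en k (U (Suc k)) (U k)" "1 \<notin> U 0" "\<And>k. \<exists>x\<in>U k. x \<noteq> 0"
proof -
  have "\<exists>V. \<forall>i. finite_approximation en (V i) \<and> ((\<forall>k. V i k \<subseteq> V (Suc i) k) \<and> (\<exists>x\<in>V (Suc i) i. x \<noteq> 0))"
  proof (intro dependent_nat_choice)
    show "\<exists>V. finite_approximation en V"
      by (intro exI[of _ "\<lambda>_. {0}"]) (auto simp: finite_approximation_def hensel_step_trivial)
  next
    fix V i assume "finite_approximation en V"
    then show "\<exists>V'. finite_approximation en V' \<and> ((\<forall>k. V k \<subseteq> V' k) \<and> (\<exists>x\<in>V' i. x \<noteq> 0))"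
      using finite_approximation_extend[OF large, of en V i] by metis
  qed
  then obtain V where V: "\<And>i. finite_approximation en (V i)" "\<And>i k. V i k \<subseteq> V (Suc i) k"
    "\<And>i. \<exists>x\<in>V (Suc i) i. x \<noteq> 0" by blast
  have mono: "V i k \<subseteq> V j k" if "i \<le> j" for i j k
    using V(2) that by (rule lift_Suc_mono_le[of "\<lambda>i. V i k"])
  have step: "hensel_step en k (V i (Suc k)) (V i k)" for i k
    using V(1) by (auto simp: finite_approximation_def)
  define U where "U k = (\<Union>i. V i k)" for k
  have U: "V i k \<subseteq> U k" for i k by (auto simp: U_def)
  have "hensel_step en k (U (Suc k)) (U k)" for k
    unfolding hensel_step_def
  proof (intro conjI ballI allI impI)
    show "0 \<in> U (Suc k)" using hensel_stepD(1)[OF step[of k 0]] by (auto simp: U_def)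
    show "U (Suc k) \<subseteq> U k" using hensel_stepD(2)[OF step] by (auto simp: U_def)
    fix x assume "x \<in> U (Suc k)"
    then obtain i where i: "x \<in> V i (Suc k)" by (auto simp: U_def)
    show "- x \<in> U k" "j \<le> k \<Longrightarrow> en j * x \<in> U k" for j
      using hensel_stepD(5,6)[OF step i] U by auto
    show "\<exists>y\<in>U k. (1 + x) * (1 + y) = 1" using hensel_stepD(7)[OF step i] U by blast
    fix y assume "y \<in> U (Suc k)"
    then obtain j where j: "y \<in> V j (Suc k)" by (auto simp: U_def)
    have "x \<in> V (max i j) (Suc k)" "y \<in> V (max i j) (Suc k)"
      using i j mono[of i "max i j"] mono[of j "max i j"] by auto
    from hensel_stepD(3,4)[OF step this] show "x + y \<in> U k" "x * y \<in> U k" using U by auto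
  next
    fix n c assume n: "n \<in> {2..k + 2}" and "\<forall>i\<le>n - 2. c i \<in> U (Suc k)"
    then have "\<forall>i. \<exists>j. i \<le> n - 2 \<longrightarrow> c i \<in> V j (Suc k)" by (auto simp: U_def)
    then obtain j where j: "\<And>i. i \<le> n - 2 \<Longrightarrow> c i \<in> V (j i) (Suc k)" by metis
    define J where "J = Max (j ` {..n - 2})"
    have c: "c i \<in> V J (Suc k)" if "i \<le> n - 2" for i
    proof -
      have "j i \<le> J" unfolding J_def using that by (intro Max_ge) auto
      then show ?thesis using j[OF that] mono by blast
    qed
    have n2: "2 \<le> n" "n \<le> k + 2" using n by auto
    from hensel_stepD(8)[OF step n2, of c J] c
    show "\<exists>y\<in>U k. \<exists>e\<in>U k. poly (hpoly n c) (y - 1) = 0 \<and>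
           (- 1) ^ (n - 1) * poly (pderiv (hpoly n c)) (y - 1) * (1 + e) = 1"
      using U[of J k] by blast
  qed
  moreover have "1 \<notin> U 0" using V(1) by (auto simp: U_def finite_approximation_def)
  moreover have "\<exists>x\<in>U k. x \<noteq> 0" for k using V(3)[of k] U by blast
  ultimately show ?thesis using that by blast
qed

section \<open>The topology of a filtration\<close>

text \<open>The sets \<open>x + U k\<close> are neighbourhoods but need not be open, as each level
  is controlled by the next one and not by itself.\<close>

lemma gt_henselian_topology_of_filtration:
  fixes U :: "nat \<Rightarrow> 'a::field set"
  assumes step: "\<And>k. hensel_step en k (U (Suc k)) (U k)" and en: "surj en"
    and one: "1 \<notin> U 0" and nontriv: "\<And>k. \<exists>x\<in>U k. x \<noteq> 0"
  obtains \<tau> :: "'a topology" where "field_topology \<tau>" "gt_henselian \<tau>"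
proof -
  have mono: "U l \<subseteq> U k" if "k \<le> l" for k l using hensel_step_antimono[OF step that] .
  have zero: "0 \<in> U k" for k using hensel_stepD(1,2)[OF step[of k]] by auto
  have add: "x + y \<in> U k" if "x \<in> U (Suc k)" "y \<in> U (Suc k)" for x y k
    using hensel_stepD(3)[OF step that] .
  have scale: "\<exists>l. \<forall>u\<in>U l. x * u \<in> U k" for x k
  proof -
    obtain j where j: "x = en j" using en by (auto simp: surj_def)
    have "x * u \<in> U k" if "u \<in> U (Suc (max j k))" for u
      using hensel_stepD(6)[OF step that, of j] mono[of k "max j k"] by (auto simp: j)
    then show ?thesis by blast
  qed
  define op where "op W \<longleftrightarrow> (\<forall>x\<in>W. \<exists>k. \<forall>u\<in>U k. x + u \<in> W)" for W
  have "istopology op"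
    unfolding istopology_def
  proof (intro conjI allI impI)
    fix S T assume ST: "op S" "op T"
    show "op (S \<inter> T)"
      unfolding op_def
    proof
      fix x assume "x \<in> S \<inter> T"
      then obtain k l where "\<forall>u\<in>U k. x + u \<in> S" "\<forall>u\<in>U l. x + u \<in> T" using ST by (force simp: op_def)
      then have "\<forall>u\<in>U (max k l). x + u \<in> S \<inter> T" using mono[of k "max k l"] mono[of l "max k l"] by auto
      then show "\<exists>k. \<forall>u\<in>U k. x + u \<in> S \<inter> T" ..
    qed
  next
    fix \<K> assume "\<forall>K\<in>\<K>. op K"
    then show "op (\<Union>\<K>)" unfolding op_def by (meson UnionE UnionI)
  qed
  define \<tau> where "\<tau> = topology op"
  have openin: "openin \<tau> W \<longleftrightarrow> (\<forall>x\<in>W. \<exists>k. \<forall>u\<in>U k. x + u \<in> W)" for W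
    unfolding \<tau>_def topology_inverse'[OF \<open>istopology op\<close>] op_def ..
  have "openin \<tau> UNIV" by (simp add: openin)
  then have top: "topspace \<tau> = UNIV" by (metis openin_subset top.extremum_unique)
  have nbhdI: "\<exists>W. openin \<tau> W \<and> x \<in> W \<and> W \<subseteq> N" if N: "\<And>u. u \<in> U k \<Longrightarrow> x + u \<in> N" for x N k
  proof (intro exI conjI)
    let ?W = "{y. \<exists>m. \<forall>u\<in>U m. y + u \<in> N}"
    show "openin \<tau> ?W"
      unfolding openin
    proof
      fix y assume "y \<in> ?W"
      then obtain m where m: "\<And>u. u \<in> U m \<Longrightarrow> y + u \<in> N" by auto
      have "y + u \<in> ?W" if "u \<in> U (Suc m)" for u
        using m add that by (intro CollectI exI[of _ "Suc m"]) (simp add: add.assoc)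
      then show "\<exists>k. \<forall>u\<in>U k. y + u \<in> ?W" by blast
    qed
    show "x \<in> ?W" using N by blast
    show "?W \<subseteq> N" using zero by force
  qed
  have binary: "continuous_map (prod_topology \<tau> \<tau>) \<tau> (\<lambda>(x, y). f x y)"
    if f: "\<And>x y k. \<exists>l. \<forall>u\<in>U l. \<forall>v\<in>U l. f (x + u) (y + v) - f x y \<in> U k" for f
    unfolding continuous_map
  proof (intro conjI allI impI)
    show "(\<lambda>(x, y). f x y) ` topspace (prod_topology \<tau> \<tau>) \<subseteq> topspace \<tau>" by (simp add: top)
    fix W assume W: "openin \<tau> W"
    show "openin (prod_topology \<tau> \<tau>) {z \<in> topspace (prod_topology \<tau> \<tau>). (\<lambda>(x, y). f x y) z \<in> W}"
      unfolding openin_prod_topology_alt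
    proof (intro allI impI)
      fix x y assume "(x, y) \<in> {z \<in> topspace (prod_topology \<tau> \<tau>). (\<lambda>(x, y). f x y) z \<in> W}"
      then have "f x y \<in> W" by simp
      then obtain k where k: "\<And>u. u \<in> U k \<Longrightarrow> f x y + u \<in> W" using W openin by blast
      obtain l where l: "\<And>u v. u \<in> U l \<Longrightarrow> v \<in> U l \<Longrightarrow> f (x + u) (y + v) - f x y \<in> U k"
        using f by blast
      obtain A where A: "openin \<tau> A" "x \<in> A" "A \<subseteq> (+) x ` U l" using nbhdI[of l x "(+) x ` U l"] by auto
      obtain B where B: "openin \<tau> B" "y \<in> B" "B \<subseteq> (+) y ` U l" using nbhdI[of l y "(+) y ` U l"] by auto
      have "f (x + u) (y + v) \<in> W" if "u \<in> U l" "v \<in> U l" for u v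
        using k[OF l[OF that]] by simp
      then have "f a b \<in> W" if "a \<in> A" "b \<in> B" for a b
        using that A(3) B(3) by blast
      then have "A \<times> B \<subseteq> {z \<in> topspace (prod_topology \<tau> \<tau>). (\<lambda>(x, y). f x y) z \<in> W}"
        by (auto simp: top)
      with A B show "\<exists>A B. openin \<tau> A \<and> openin \<tau> B \<and> x \<in> A \<and> y \<in> B \<and>
          A \<times> B \<subseteq> {z \<in> topspace (prod_topology \<tau> \<tau>). (\<lambda>(x, y). f x y) z \<in> W}" by blast
    qed
  qed
  have c_add: "continuous_map (prod_topology \<tau> \<tau>) \<tau> (\<lambda>(x, y). x + y)"
  proof (rule binary)
    fix x y k
    show "\<exists>l. \<forall>u\<in>U l. \<forall>v\<in>U l. x + u + (y + v) - (x + y) \<in> U k"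
      using add by (intro exI[of _ "Suc k"]) (simp add: algebra_simps)
  qed
  have c_mult: "continuous_map (prod_topology \<tau> \<tau>) \<tau> (\<lambda>(x, y). x * y)"
  proof (rule binary)
    fix x y k
    obtain l m where l: "\<And>u. u \<in> U l \<Longrightarrow> x * u \<in> U (Suc (Suc k))"
      and m: "\<And>u. u \<in> U m \<Longrightarrow> y * u \<in> U (Suc (Suc k))"
      using scale by metis
    let ?n = "max (max l m) (Suc (Suc k))"
    have "(x + u) * (y + v) - x * y \<in> U k" if uv: "u \<in> U ?n" "v \<in> U ?n" for u v
    proof -
      have "m \<le> ?n" "l \<le> ?n" by auto
      with uv mono have "u \<in> U m" "v \<in> U l" by blast+
      then have "x * v + y * u \<in> U (Suc k)" using l m add by blast
      moreover have "u * v \<in> U (Suc k)"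
        using uv mono[of "Suc (Suc k)" ?n] hensel_stepD(4)[OF step[of "Suc k"]] by auto
      ultimately have "x * v + y * u + u * v \<in> U k" by (rule add)
      then show ?thesis by (simp add: algebra_simps)
    qed
    then show "\<exists>l. \<forall>u\<in>U l. \<forall>v\<in>U l. (x + u) * (y + v) - x * y \<in> U k" by blast
  qed
  have c_uminus: "continuous_map \<tau> \<tau> uminus"
    unfolding continuous_map
  proof (intro conjI allI impI)
    fix W assume W: "openin \<tau> W"
    show "openin \<tau> {x \<in> topspace \<tau>. - x \<in> W}"
      unfolding openin
    proof
      fix x assume "x \<in> {x \<in> topspace \<tau>. - x \<in> W}"
      then obtain k where k: "\<And>u. u \<in> U k \<Longrightarrow> - x + u \<in> W" using W openin by blast
      have "- (x + u) \<in> W" if "u \<in> U (Suc k)" for u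
        using k[OF hensel_stepD(5)[OF step that]] by simp
      then show "\<exists>k. \<forall>u\<in>U k. x + u \<in> {x \<in> topspace \<tau>. - x \<in> W}" by (auto simp: top)
    qed
  qed (simp add: top)
  have c_inverse: "continuous_map (subtopology \<tau> (UNIV - {0})) \<tau> inverse"
    unfolding continuous_map
  proof (intro conjI allI impI)
    fix W assume W: "openin \<tau> W"
    let ?S = "{x. x \<noteq> 0 \<and> inverse x \<in> W}"
    have "openin \<tau> ?S"
      unfolding openin
    proof
      fix x assume x: "x \<in> ?S"
      then obtain k where k: "\<And>u. u \<in> U k \<Longrightarrow> inverse x + u \<in> W" using W openin by blast
      \<comment> \<open>The inverse of \<open>x + u\<close> will be
        \<open>inverse x + inverse x * y\<close>, where \<open>1 + y\<close> inverts
        \<open>1 + inverse x * u\<close>. So \<open>y\<close> has to be in \<open>U l\<close>, and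
        \<open>inverse x * u\<close> one level deeper.\<close>
      obtain l where l: "\<And>u. u \<in> U l \<Longrightarrow> inverse x * u \<in> U k" using scale by blast
      obtain m where m: "\<And>u. u \<in> U m \<Longrightarrow> inverse x * u \<in> U (Suc l)" using scale by blast
      have "x + u \<in> ?S" if u: "u \<in> U m" for u
      proof -
        obtain y where y: "y \<in> U l" "(1 + inverse x * u) * (1 + y) = 1"
          using hensel_stepD(7)[OF step m[OF u]] by blast
        define v where "v = inverse x * u"
        have xu: "x + u = x * (1 + v)" using x by (simp add: v_def algebra_simps)
        have "(x + u) * (inverse x + inverse x * y) = x * inverse x * ((1 + v) * (1 + y))"
          unfolding xu by (simp add: algebra_simps)
        also have "\<dots> = 1" using x y(2) by (simp add: v_def)
        finally have *: "(x + u) * (inverse x + inverse x * y) = 1" .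
        then have "x + u \<noteq> 0" by auto
        moreover have "inverse (x + u) = inverse x + inverse x * y" using * by (rule inverse_unique)
        ultimately show ?thesis using k[OF l[OF y(1)]] by simp
      qed
      then show "\<exists>k. \<forall>u\<in>U k. x + u \<in> ?S" by blast
    qed
    moreover have "{x \<in> topspace (subtopology \<tau> (UNIV - {0})). inverse x \<in> W} = ?S \<inter> (UNIV - {0})"
      by (auto simp: top)
    ultimately show "openin (subtopology \<tau> (UNIV - {0})) {x \<in> topspace (subtopology \<tau> (UNIV - {0})). inverse x \<in> W}"
      unfolding openin_subtopology by blast
  qed (simp add: top)
  have hausdorff: "Hausdorff_space \<tau>"
    unfolding Hausdorff_space_def
  proof (intro allI impI)
    fix x y assume "x \<in> topspace \<tau> \<and> y \<in> topspace \<tau> \<and> x \<noteq> y"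
    then have d: "x - y \<noteq> 0" by simp
    obtain j where j: "inverse (x - y) = en j" using en by (auto simp: surj_def)
    \<comment> \<open>Otherwise multiplication by \<open>en j = inverse (x - y)\<close> would put 1
      into \<open>U j\<close>, hence into \<open>U 0\<close>.\<close>
    have k: "x - y \<notin> U (Suc j)" (is "_ \<notin> U ?k")
    proof
      assume "x - y \<in> U (Suc j)"
      from hensel_stepD(6)[OF step this, of j] have "en j * (x - y) \<in> U 0" using mono[of 0 j] by auto
      with one j d show False by (metis left_inverse)
    qed
    \<comment> \<open>One level is spent on a negation and one on a sum.\<close>
    let ?l = "Suc (Suc ?k)"
    obtain A where A: "openin \<tau> A" "x \<in> A" "A \<subseteq> (+) x ` U ?l" using nbhdI[of ?l x "(+) x ` U ?l"] by auto
    obtain B where B: "openin \<tau> B" "y \<in> B" "B \<subseteq> (+) y ` U ?l" using nbhdI[of ?l y "(+) y ` U ?l"] by auto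
    have "disjnt A B"
      unfolding disjnt_iff
    proof (intro allI notI)
      fix w assume "w \<in> A \<and> w \<in> B"
      then obtain u v where uv: "u \<in> U ?l" "v \<in> U ?l" "x + u = y + v" using A(3) B(3) by blast
      have "v + - u \<in> U ?k"
        using add[of v ?k "- u"] hensel_stepD(5)[OF step uv(1)] uv(2) mono[of "Suc ?k" ?l] by auto
      moreover have "x - y = v + - u" using uv(3) by (simp add: algebra_simps)
      ultimately show False using k by simp
    qed
    with A B show "\<exists>A B. openin \<tau> A \<and> openin \<tau> B \<and> x \<in> A \<and> y \<in> B \<and> disjnt A B" by blast
  qed
  have "\<tau> \<noteq> discrete_topology UNIV"
  proof
    assume "\<tau> = discrete_topology UNIV"
    then have "openin \<tau> {0}" by simp
    then obtain k where "\<forall>u\<in>U k. u = 0" by (auto simp: openin)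
    with nontriv show False by blast
  qed
  then have "field_topology \<tau>"
    unfolding field_topology_def using top c_add c_uminus c_mult c_inverse hausdorff by blast
  moreover have "gt_henselian \<tau>"
    unfolding gt_henselian_def
  proof (intro allI impI)
    fix n :: nat and N assume n: "2 \<le> n" and "is_nbhd \<tau> (- 1) N"
    then obtain W where "openin \<tau> W" "- 1 \<in> W" "W \<subseteq> N" by (auto simp: is_nbhd_def)
    then obtain k where k: "\<And>u. u \<in> U k \<Longrightarrow> - 1 + u \<in> N" unfolding openin by blast
    \<comment> \<open>Deep enough to fit into \<open>N\<close> and to cover degree \<open>n\<close>,
      which needs \<open>n \<le> ?k + 2\<close>.\<close>
    let ?k = "max k (n - 2)"
    have "is_nbhd \<tau> 0 (U (Suc ?k))"
      unfolding is_nbhd_def by (rule nbhdI[of "Suc ?k"]) simp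
    moreover have "\<exists>x\<in>N. poly (monom 1 n + monom 1 (n - 1) + (\<Sum>i\<le>n - 2. monom (c i) i)) x = 0"
      if c: "\<forall>i\<le>n - 2. c i \<in> U (Suc ?k)" for c
    proof -
      have "n \<le> ?k + 2" by simp
      then have "\<exists>y\<in>U ?k. \<exists>e\<in>U ?k. poly (hpoly n c) (y - 1) = 0 \<and>
          (- 1) ^ (n - 1) * poly (pderiv (hpoly n c)) (y - 1) * (1 + e) = 1"
        using c by (intro hensel_stepD(8)[OF step n]) simp_all
      then obtain y where y: "y \<in> U ?k" "poly (hpoly n c) (y - 1) = 0" by blast
      have "- 1 + y \<in> N" using k y(1) mono[of k ?k] by auto
      moreover have "poly (hpoly n c) (- 1 + y) = 0" using y(2) by (simp only: add.commute diff_conv_add_uminus)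
      ultimately show ?thesis unfolding hpoly_def by blast
    qed
    ultimately show "\<exists>V. is_nbhd \<tau> 0 V \<and> (\<forall>c. (\<forall>i\<le>n - 2. c i \<in> V) \<longrightarrow>
        (\<exists>x\<in>N. poly (monom 1 n + monom 1 (n - 1) + (\<Sum>i\<le>n - 2. monom (c i) i)) x = 0))" by blast
  qed
  ultimately show ?thesis using that by blast
qed

section \<open>Fields with a gt-henselian topology are large\<close>

text \<open>Continuity at one point is the right notion for functions such as
  \<open>inverse (a 1 x)\<close>, whose denominator is only known to be nonzero at 0.\<close>

definition continuous_at_zero :: "'a::zero topology \<Rightarrow> ('a \<Rightarrow> 'a) \<Rightarrow> bool" where
  "continuous_at_zero \<tau> f \<longleftrightarrow> (\<forall>W. openin \<tau> W \<and> f 0 \<in> W \<longrightarrow>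
     (\<exists>A. openin \<tau> A \<and> 0 \<in> A \<and> (\<forall>x\<in>A. f x \<in> W)))"

lemma continuous_at_zero_compose2:
  assumes g: "continuous_map (prod_topology \<tau> \<tau>) \<tau> (\<lambda>(x, y). g x y)" and top: "topspace \<tau> = UNIV"
    and "continuous_at_zero \<tau> f1" "continuous_at_zero \<tau> f2"
  shows "continuous_at_zero \<tau> (\<lambda>x. g (f1 x) (f2 x))"
  unfolding continuous_at_zero_def
proof (intro allI impI)
  fix W assume W: "openin \<tau> W \<and> g (f1 0) (f2 0) \<in> W"
  define P where "P = {z \<in> topspace (prod_topology \<tau> \<tau>). (\<lambda>(x, y). g x y) z \<in> W}"
  have "openin (prod_topology \<tau> \<tau>) P"
    using g W unfolding continuous_map P_def by blast
  moreover have "(f1 0, f2 0) \<in> P"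
    using W by (simp add: P_def top)
  ultimately obtain A B where AB: "openin \<tau> A" "openin \<tau> B" "f1 0 \<in> A" "f2 0 \<in> B" "A \<times> B \<subseteq> P"
    by (metis openin_prod_topology_alt)
  obtain A' where A': "openin \<tau> A'" "0 \<in> A'" "\<forall>x\<in>A'. f1 x \<in> A"
    using assms(3) AB(1,3) unfolding continuous_at_zero_def by blast
  obtain B' where B': "openin \<tau> B'" "0 \<in> B'" "\<forall>x\<in>B'. f2 x \<in> B"
    using assms(4) AB(2,4) unfolding continuous_at_zero_def by blast
  have "g (f1 x) (f2 x) \<in> W" if "x \<in> A' \<inter> B'" for x
  proof -
    have "(f1 x, f2 x) \<in> P" using that A'(3) B'(3) AB(5) by blast
    then show ?thesis by (simp add: P_def)
  qed
  then show "\<exists>A. openin \<tau> A \<and> 0 \<in> A \<and> (\<forall>x\<in>A. g (f1 x) (f2 x) \<in> W)"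
    using A' B' by (intro exI[of _ "A' \<inter> B'"]) auto
qed

lemma gt_henselian_imp_large:
  fixes \<tau> :: "'a::field topology"
  assumes ft: "field_topology \<tau>" and gt: "gt_henselian \<tau>"
  shows "large_field TYPE('a)"
  unfolding large_field_def
proof (intro allI impI)
  fix f :: "'a poly poly" assume f: "eval_XY f 0 0 = 0 \<and> eval_XY (pderiv f) 0 0 \<noteq> 0"
  have top: "topspace \<tau> = UNIV" and haus: "Hausdorff_space \<tau>" and nd: "\<tau> \<noteq> discrete_topology UNIV"
    and c_inv: "continuous_map (subtopology \<tau> (UNIV - {0})) \<tau> inverse"
    and c_add: "continuous_map (prod_topology \<tau> \<tau>) \<tau> (\<lambda>(x, y). x + y)"
    and c_mult: "continuous_map (prod_topology \<tau> \<tau>) \<tau> (\<lambda>(x, y). x * y)"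
    using ft unfolding field_topology_def by auto
  have t1: "openin \<tau> (UNIV - F)" if "finite F" for F
  proof -
    have "closedin \<tau> F"
      using Hausdorff_imp_t1_space[OF haus] that by (simp add: t1_space_closedin_finite top)
    then show ?thesis by (simp add: closedin_def top)
  qed
  \<comment> \<open>A finite open set around 0 would make \<open>{0}\<close> open by the T1
    property, and then translations would make the topology discrete.\<close>
  have open_inf: "infinite A" if A: "openin \<tau> A" "0 \<in> A" for A
  proof
    assume "finite A"
    then have "openin \<tau> (A \<inter> (UNIV - (A - {0})))" using A t1 by (intro openin_Int) auto
    moreover have "A \<inter> (UNIV - (A - {0})) = {0}" using A(2) by auto
    ultimately have o: "openin \<tau> {0}" by simp
    have "openin \<tau> {x}" for x
    proof -
      have "continuous_map \<tau> \<tau> (\<lambda>y. (\<lambda>(x, y). x + y) (y, - x))"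
        by (rule continuous_map_compose[OF _ c_add, unfolded o_def])
           (simp add: continuous_map_pairwise o_def top)
      then have "openin \<tau> {y \<in> topspace \<tau>. y + - x \<in> {0}}"
        using o unfolding continuous_map by auto
      moreover have "{y \<in> topspace \<tau>. y + - x \<in> {0}} = {x}" by (auto simp: top)
      ultimately show ?thesis by simp
    qed
    then have "\<tau> = discrete_topology UNIV" using top discrete_topology_unique[of UNIV \<tau>] by auto
    with nd show False by blast
  qed
  note c_intros = continuous_at_zero_compose2[OF c_add top] continuous_at_zero_compose2[OF c_mult top]
  have c_const: "continuous_at_zero \<tau> (\<lambda>_. c)" for c
    unfolding continuous_at_zero_def using top by (metis UNIV_I openin_topspace)
  have c_id: "continuous_at_zero \<tau> (\<lambda>x. x)" by (auto simp: continuous_at_zero_def)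
  have c_poly: "continuous_at_zero \<tau> (\<lambda>x. poly p x)" for p
  proof (induction p)
    case 0
    show ?case using c_const[of 0] by simp
  next
    case (pCons a p)
    have "continuous_at_zero \<tau> (\<lambda>x. a + x * poly p x)"
      by (intro c_intros c_const c_id pCons.IH)
    then show ?case by simp
  qed
  have c_power: "continuous_at_zero \<tau> (\<lambda>x. g x ^ k)" if "continuous_at_zero \<tau> g" for g k
  proof (induction k)
    case 0
    show ?case using c_const[of 1] by simp
  next
    case (Suc k)
    have "continuous_at_zero \<tau> (\<lambda>x. g x * g x ^ k)" by (intro c_intros that Suc.IH)
    then show ?case by simp
  qed
  have c_inverse: "continuous_at_zero \<tau> (\<lambda>x. inverse (g x))"
    if g: "continuous_at_zero \<tau> g" "g 0 \<noteq> 0" for g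
    unfolding continuous_at_zero_def
  proof (intro allI impI)
    fix W assume W: "openin \<tau> W \<and> inverse (g 0) \<in> W"
    then have "openin (subtopology \<tau> (UNIV - {0})) {x \<in> topspace (subtopology \<tau> (UNIV - {0})). inverse x \<in> W}"
      using c_inv unfolding continuous_map by blast
    then obtain T where T: "openin \<tau> T"
      "{x \<in> topspace (subtopology \<tau> (UNIV - {0})). inverse x \<in> W} = T \<inter> (UNIV - {0})"
      unfolding openin_subtopology by blast
    have "g 0 \<in> T \<inter> (UNIV - {0})" using W g(2) unfolding T(2)[symmetric] by (simp add: top)
    moreover have "openin \<tau> (T \<inter> (UNIV - {0}))" using T(1) t1[of "{0}"] by (intro openin_Int) auto
    ultimately obtain A where "openin \<tau> A" "0 \<in> A" "\<forall>x\<in>A. g x \<in> T \<inter> (UNIV - {0})"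
      using g(1) unfolding continuous_at_zero_def by blast
    then show "\<exists>A. openin \<tau> A \<and> 0 \<in> A \<and> (\<forall>x\<in>A. inverse (g x) \<in> W)"
      unfolding T(2)[symmetric] by blast
  qed
  define n where "n = max 2 (degree f)"
  have n2: "n \<ge> 2" by (simp add: n_def)
  define a where "a i x = poly (coeff f i) x" for i x
  have eval: "eval_XY f x y = (\<Sum>i\<le>n. a i x * y ^ i)" for x y
  proof -
    let ?p = "map_poly (\<lambda>q. poly q x) f"
    have "degree ?p \<le> n"
      using map_poly_degree_leq[of "\<lambda>q. poly q x" f] by (simp add: n_def)
    then have "poly ?p y = poly (\<Sum>i\<le>n. monom (coeff ?p i) i) y"
      by (simp add: poly_as_sum_of_monoms')
    then show ?thesis
      by (simp add: eval_XY_map_poly poly_sum poly_monom a_def coeff_map_poly)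
  qed
  have a0: "a 0 0 = 0" using f by (simp add: eval_XY_origin a_def poly_0_coeff_0)
  have a1: "a 1 0 \<noteq> 0" using f by (simp add: eval_XY_origin a_def poly_0_coeff_0 coeff_pderiv)
  \<comment> \<open>The coefficient of \<open>w ^ (n - i)\<close> after the substitution and
    division by \<open>a 0 x\<close>. It is 1 for \<open>i = 1\<close> when \<open>a 1 x\<close> is
    nonzero, and for \<open>i \<ge> 2\<close> a positive power of \<open>a 0 x\<close> remains, so
    that it vanishes at 0.\<close>
  define e where "e i x = a i x * (a 0 x ^ (i - 1) * inverse (a 1 x) ^ i)" for i x
  have ce: "continuous_at_zero \<tau> (e i)" for i
  proof -
    have "continuous_at_zero \<tau> (\<lambda>x. a j x)" for j unfolding a_def by (rule c_poly)
    then show ?thesis unfolding e_def using a1 by (intro c_intros c_power c_inverse) auto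
  qed
  have e0: "e i 0 = 0" if "i \<ge> 2" for i using that a0 by (simp add: e_def power_0_left)
  \<comment> \<open>Of the root \<open>w\<close> only \<open>w \<noteq> 0\<close> is required, so
    that \<open>y\<close> can be formed with \<open>inverse w\<close>.\<close>
  have "is_nbhd \<tau> (- 1) (UNIV - {0})"
    unfolding is_nbhd_def using t1[of "{0}"] by (intro exI[of _ "UNIV - {0}"]) auto
  then obtain V where V: "is_nbhd \<tau> 0 V"
    "\<And>c. \<forall>i\<le>n - 2. c i \<in> V \<Longrightarrow> \<exists>x\<in>UNIV - {0}. poly (monom 1 n + monom 1 (n - 1) + (\<Sum>i\<le>n - 2. monom (c i) i)) x = 0"
    using gt n2 unfolding gt_henselian_def by blast
  obtain V' where V': "openin \<tau> V'" "0 \<in> V'" "V' \<subseteq> V" using V(1) by (auto simp: is_nbhd_def)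
  have "\<forall>i\<in>{2..n}. \<exists>A. openin \<tau> A \<and> 0 \<in> A \<and> (\<forall>x\<in>A. e i x \<in> V')"
    using ce e0 V' unfolding continuous_at_zero_def by (metis atLeastAtMost_iff)
  then obtain A where A: "\<And>i. i \<in> {2..n} \<Longrightarrow> openin \<tau> (A i) \<and> 0 \<in> A i \<and> (\<forall>x\<in>A i. e i x \<in> V')"
    by metis
  obtain A1 where A1: "openin \<tau> A1" "0 \<in> A1" "\<forall>x\<in>A1. a 1 x \<in> UNIV - {0}"
    using c_poly[of "coeff f 1"] a1 t1[of "{0}"] unfolding continuous_at_zero_def a_def by blast
  define N where "N = A1 \<inter> (\<Inter>i\<in>{2..n}. A i)"
  have "openin \<tau> (\<Inter>i\<in>{2..n}. A i)" using A n2 by (intro openin_Inter) auto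
  then have N: "openin \<tau> N" "0 \<in> N" using A A1 by (auto simp: N_def)
  have root: "\<exists>y. eval_XY f x y = 0" if x: "x \<in> N" for x
  proof (cases "a 0 x = 0")
    case True
    have "(\<Sum>i\<le>n. a i x * 0 ^ i) = 0" using True by (intro sum.neutral) (auto simp: power_0_left)
    then show ?thesis unfolding eval by blast
  next
    case False
    have a1x: "a 1 x \<noteq> 0" using x A1(3) by (auto simp: N_def)
    define c where "c j = e (n - j) x" for j
    have "c j \<in> V" if "j \<le> n - 2" for j
      using A[of "n - j"] that n2 x V'(3) by (auto simp: c_def N_def)
    then obtain w where w: "w \<noteq> 0" "poly (monom 1 n + monom 1 (n - 1) + (\<Sum>i\<le>n - 2. monom (c i) i)) w = 0"
      using V(2)[of c] by auto
    define y where "y = a 0 x * inverse (a 1 x) * inverse w"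
    obtain m where m: "n = Suc (Suc m)" using n2 by (metis le_Suc_ex add_2_eq_Suc)
    have summand: "w ^ n * (a i x * y ^ i) = a 0 x * (e i x * w ^ (n - i))" if "1 \<le> i" "i \<le> n" for i
    proof -
      have "w ^ n = w ^ (n - i) * w ^ i" using that by (simp flip: power_add)
      moreover have "a 0 x ^ i = a 0 x * a 0 x ^ (i - 1)" using that by (cases i) auto
      moreover have "w ^ i * inverse w ^ i = 1" using w(1) by (simp flip: power_mult_distrib)
      ultimately show ?thesis
        unfolding y_def e_def power_mult_distrib by (simp add: algebra_simps)
    qed
    have e1: "e 1 x = 1" using a1x by (simp add: e_def)
    have s1: "w ^ n * (a 1 x * y ^ 1) = a 0 x * (e 1 x * w ^ (n - 1))"
      by (rule summand) (use n2 in auto)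
    have s2: "(\<Sum>i\<le>m. w ^ n * (a (Suc (Suc i)) x * y ^ Suc (Suc i)))
        = (\<Sum>i\<le>m. a 0 x * (e (Suc (Suc i)) x * w ^ (n - Suc (Suc i))))"
      by (intro sum.cong refl summand) (auto simp: m)
    have "w ^ n * eval_XY f x y = (\<Sum>i\<le>Suc (Suc m). w ^ n * (a i x * y ^ i))"
      by (simp only: eval sum_distrib_left m)
    also have "\<dots> = w ^ n * (a 0 x * y ^ 0) + (w ^ n * (a 1 x * y ^ 1)
        + (\<Sum>i\<le>m. w ^ n * (a (Suc (Suc i)) x * y ^ Suc (Suc i))))"
      by (simp only: sum.atMost_Suc_shift One_nat_def)
    also have "\<dots> = a 0 x * w ^ n + (a 0 x * (e 1 x * w ^ (n - 1))
        + (\<Sum>i\<le>m. a 0 x * (e (Suc (Suc i)) x * w ^ (n - Suc (Suc i)))))"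
      by (simp only: s1 s2 power_0 mult_1_right mult.commute[of "w ^ n" "a 0 x"])
    also have "(\<Sum>i\<le>m. a 0 x * (e (Suc (Suc i)) x * w ^ (n - Suc (Suc i))))
        = (\<Sum>i\<le>m. a 0 x * (c i * w ^ i))"
      by (rule sum.reindex_bij_witness[of _ "\<lambda>i. m - i" "\<lambda>i. m - i"]) (auto simp: c_def m Suc_diff_le)
    also have "a 0 x * w ^ n + (a 0 x * (e 1 x * w ^ (n - 1)) + \<dots>) =
        a 0 x * (w ^ n + w ^ (n - 1) + (\<Sum>i\<le>m. c i * w ^ i))"
      unfolding e1 by (simp add: sum_distrib_left algebra_simps)
    also have "w ^ n + w ^ (n - 1) + (\<Sum>i\<le>m. c i * w ^ i) = 0"
      using w(2) by (simp add: poly_sum poly_monom m)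
    finally show ?thesis using w(1) by auto
  qed
  show "infinite {(x, y). eval_XY f x y = 0}"
  proof
    assume "finite {(x, y). eval_XY f x y = 0}"
    then have "finite (fst ` {(x, y). eval_XY f x y = 0})" by (rule finite_imageI)
    moreover have "N \<subseteq> fst ` {(x, y). eval_XY f x y = 0}" using root by force
    ultimately show False using open_inf[OF N] finite_subset by blast
  qed
qed

theorem theorem1p2:
  assumes "countable (UNIV :: 'a::field set)"
  shows "large_field TYPE('a) \<longleftrightarrow> (\<exists>\<tau> :: 'a topology. field_topology \<tau> \<and> gt_henselian \<tau>)"
proof
  assume "large_field TYPE('a)"
  then obtain U where "\<And>k. hensel_step (from_nat_into (UNIV :: 'a set)) k (U (Suc k)) (U k)"
    "1 \<notin> U 0" "\<And>k. \<exists>x\<in>U k. x \<noteq> 0"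
    using hensel_filtration_exists by blast
  moreover have "surj (from_nat_into (UNIV :: 'a set))"
    using assms by (simp add: range_from_nat_into)
  ultimately show "\<exists>\<tau> :: 'a topology. field_topology \<tau> \<and> gt_henselian \<tau>"
    using gt_henselian_topology_of_filtration by blast
qed (use gt_henselian_imp_large in blast)

end
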